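(* Let $f\in L^2(\mathbb R_t\times\mathbb R^n_x;H^1(\mathbb R^n_v))$ be such that $(\partial_t+v\cdot\nabla_x)f=\nabla_v\cdot S$ in the sense of distributions for some $S\in L^2(\mathbb R^{1+2n};\mathbb R^n)$. Then, with $\kappa=1+\frac1{2n}$, $$\|f\|_{L^{2\kappa}(\mathbb R^{1+2n})}\le C\big(\|\nabla_vf\|_{L^2(\mathbb R^{1+2n})}+\|S\|_{L^2(\mathbb R^{1+2n})}\big)$$ for a constant $C=C(n)>0$.
   Context: Variables $(t,x,v)\in\mathbb R\times\mathbb R^n\times\mathbb R^n$; $\nabla_v$ is the gradient in $v$. *)

theory Defs
  imports "HOL-Analysis.Analysis"
begin

text \<open>Phase-space points (t, x, v) in R x R^n x R^n.\<close>
type_synonym 'n phase = "real \<times> (real ^ 'n) \<times> (real ^ 'n)"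

fun Ck :: "nat \<Rightarrow> ('a::euclidean_space \<Rightarrow> real) \<Rightarrow> bool" where
  "Ck 0 \<phi> = continuous_on UNIV \<phi>"
| "Ck (Suc k) \<phi> = (continuous_on UNIV \<phi> \<and> (\<forall>z. \<phi> differentiable (at z)) \<and>
      (\<forall>h. Ck k (\<lambda>z. frechet_derivative \<phi> (at z) h)))"

definition smooth_fun :: "('a::euclidean_space \<Rightarrow> real) \<Rightarrow> bool" where
  "smooth_fun \<phi> \<longleftrightarrow> (\<forall>k. Ck k \<phi>)"

definition test_fun :: "('a::euclidean_space \<Rightarrow> real) \<Rightarrow> bool" where
  "test_fun \<phi> \<longleftrightarrow> smooth_fun \<phi> \<and> compact (closure {z. \<phi> z \<noteq> 0})"

definition dt :: "('n::finite phase \<Rightarrow> real) \<Rightarrow> 'n phase \<Rightarrow> real" where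
  "dt \<phi> z = frechet_derivative \<phi> (at z) (1, 0, 0)"

definition transport :: "('n::finite phase \<Rightarrow> real) \<Rightarrow> 'n phase \<Rightarrow> real" where
  "transport \<phi> z = frechet_derivative \<phi> (at z) (0, snd (snd z), 0)"

definition dv :: "('n::finite phase \<Rightarrow> real) \<Rightarrow> 'n \<Rightarrow> 'n phase \<Rightarrow> real" where
  "dv \<phi> i z = frechet_derivative \<phi> (at z) (0, 0, axis i 1)"

definition grad_v :: "('n::finite phase \<Rightarrow> real) \<Rightarrow> 'n phase \<Rightarrow> real ^ 'n" where
  "grad_v \<phi> z = (\<chi> i. dv \<phi> i z)"

definition L2 :: "('n::finite phase \<Rightarrow> real) \<Rightarrow> bool" where
  "L2 f \<longleftrightarrow> f \<in> borel_measurable lborel \<and> integrable lborel (\<lambda>z. (f z)\<^sup>2)"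

definition L2v :: "('n::finite phase \<Rightarrow> real ^ 'n) \<Rightarrow> bool" where
  "L2v S \<longleftrightarrow> S \<in> borel_measurable lborel \<and> integrable lborel (\<lambda>z. (norm (S z))\<^sup>2)"

definition L2norm_v :: "('n::finite phase \<Rightarrow> real ^ 'n) \<Rightarrow> real" where
  "L2norm_v S = sqrt (LINT z|lborel. (norm (S z))\<^sup>2)"

definition weak_grad_v :: "('n::finite phase \<Rightarrow> real) \<Rightarrow> ('n phase \<Rightarrow> real ^ 'n) \<Rightarrow> bool" where
  "weak_grad_v f g \<longleftrightarrow> (\<forall>\<phi> i. test_fun \<phi> \<longrightarrow>
     (LINT z|lborel. f z * dv \<phi> i z) = - (LINT z|lborel. (g z $ i) * \<phi> z))"

definition kinetic_eq :: "('n::finite phase \<Rightarrow> real) \<Rightarrow> ('n phase \<Rightarrow> real ^ 'n) \<Rightarrow> bool" where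
  "kinetic_eq f S \<longleftrightarrow> (\<forall>\<phi>. test_fun \<phi> \<longrightarrow>
     (LINT z|lborel. f z * (dt \<phi> z + transport \<phi> z)) = (LINT z|lborel. S z \<bullet> grad_v \<phi> z))"

end

theory Submission
  imports Defs
begin

text \<open>Let \<open>\<delta> r (s, y, w) = (r\<^sup>2 s, r\<^sup>3 y, r w)\<close> and let \<open>\<circ>\<close> be the Galilean group law, whose left
  translations commute with \<open>X = \<partial>\<^sub>t + v \<cdot> \<nabla>\<^sub>x\<close> and \<open>\<nabla>\<^sub>v\<close>. For a smooth bump \<open>P\<close> put
  \<open>F r z = \<integral> f (z \<circ> \<delta> r w) P w dw\<close>. Differentiating in \<open>r\<close> brings out the divergence of \<open>P\<close> times
  the dilation generator, and this is \<open>X A + \<nabla>\<^sub>w \<cdot> B\<close> with smooth compactly supported \<open>A, B\<close>. Hence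
  the two weak equations bound \<open>\<bar>\<partial>\<^sub>r F\<bar>\<close> by the average of \<open>h = \<bar>g\<bar> + \<bar>S\<bar>\<close> over the kinetic ball of
  radius \<open>r\<close>, and integrating from \<open>0\<close> to \<open>\<infinity>\<close> bounds \<open>\<bar>f\<bar>\<close> by the Riesz-type potential
  \<open>\<integral> avg r h dr\<close>.

  This potential maps \<open>L\<^sup>2\<close> to \<open>L\<^sup>p\<close>, \<open>p = 2 + 1/n\<close>, without any maximal function: at level \<open>t\<close> the
  scales \<open>r > \<rho>(t)\<close> contribute at most \<open>t/2\<close> by Cauchy-Schwarz, the part \<open>h \<le> s(t)\<close> contributes at most
  \<open>t/4\<close> on the scales \<open>r < \<rho>(t)\<close>, and the part \<open>h > s(t)\<close> is estimated in \<open>L\<^sup>1\<close>. Integrating in \<open>t\<close> with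
  Fubini gives \<open>\<integral> h\<^sup>2\<close>.\<close>

section \<open>Smooth functions and a flat function\<close>

text \<open>The exponent is dictated by scaling: volumes grow like r^Q under \<delta> r with Q = 4 n
  + 2, the potential gains one power of r, and 1/p = 1/2 - 1/Q gives p = 2 + 1/n. The obstacle is
  that nothing controls the x-derivatives of f directly. Differentiating F in r costs a factor 1/r
  and produces a derivative in y; it can be handled only because it is a commutator of the two
  derivatives that the equations do control. Pulled back to the variable w, a velocity derivative of
  f becomes r g, and the kinetic derivative becomes r^2 times the v-divergence of S, that is r times
  a w-divergence. Both equations thus bring the same factor r, which cancels 1/r and leaves the
  measure dr without a weight. The function f is never differentiated: the r-derivative falls on the
  kernel after a change of variables. The limit r -> 0 also has to do without a maximal function:
  approximation of f in L^2 by continuous functions and Fatou's lemma give the bound almost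
  everywhere.\<close>

lemma Ck_SucI:
  assumes "\<And>z. (\<phi> has_derivative \<phi>' z) (at z)" "\<And>h. Ck k (\<lambda>z. \<phi>' z h)"
  shows "Ck (Suc k) \<phi>"
proof -
  have "frechet_derivative \<phi> (at z) = \<phi>' z" for z
    using frechet_derivative_at[OF assms(1)] by simp
  moreover have "continuous_on UNIV \<phi>"
    using assms(1) by (meson continuous_at_imp_continuous_on has_derivative_continuous)
  ultimately show ?thesis
    using assms by (auto simp: differentiable_def)
qed

lemma Ck_SucD:
  assumes "Ck (Suc k) \<phi>"
  shows "(\<phi> has_derivative frechet_derivative \<phi> (at z)) (at z)"
    "Ck k (\<lambda>z. frechet_derivative \<phi> (at z) h)"
  using assms by (auto simp: frechet_derivative_works)

text \<open>In the induction for products a factor survives undifferentiated, one order smoother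
  than the induction hypothesis asks for.\<close>

lemma Ck_lessI: "Ck (Suc k) \<phi> \<Longrightarrow> Ck k \<phi>"
proof (induction k arbitrary: \<phi>)
  case (Suc k)
  then have "Ck k (\<lambda>z. frechet_derivative \<phi> (at z) h)" for h
    using Suc.IH[OF Ck_SucD(2)[OF Suc.prems]] by blast
  then show ?case
    by (intro Ck_SucI[OF Ck_SucD(1)[OF Suc.prems]])
qed simp

lemma Ck_const: "Ck k (\<lambda>_. c)"
proof (induction k arbitrary: c)
  case (Suc k)
  show ?case by (rule Ck_SucI[where \<phi>'="\<lambda>_ _. 0"]) (auto simp: Suc)
qed simp

lemma Ck_add: "Ck k \<phi> \<Longrightarrow> Ck k \<psi> \<Longrightarrow> Ck k (\<lambda>z. \<phi> z + \<psi> z)"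
proof (induction k arbitrary: \<phi> \<psi>)
  case 0
  then show ?case by (auto intro: continuous_intros)
next
  case (Suc k)
  show ?case
    by (rule Ck_SucI[OF has_derivative_add[OF Ck_SucD(1)[OF Suc.prems(1)] Ck_SucD(1)[OF Suc.prems(2)]]])
       (intro Suc.IH Ck_SucD(2)[OF Suc.prems(1)] Ck_SucD(2)[OF Suc.prems(2)])
qed

lemma Ck_mult: "Ck k \<phi> \<Longrightarrow> Ck k \<psi> \<Longrightarrow> Ck k (\<lambda>z. \<phi> z * \<psi> z)"
proof (induction k arbitrary: \<phi> \<psi>)
  case 0
  then show ?case by (auto intro: continuous_intros)
next
  case (Suc k)
  show ?case
    by (rule Ck_SucI[OF has_derivative_mult[OF Ck_SucD(1)[OF Suc.prems(1)] Ck_SucD(1)[OF Suc.prems(2)]]])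
       (intro Suc.IH Ck_add Ck_SucD(2)[OF Suc.prems(1)] Ck_SucD(2)[OF Suc.prems(2)] Ck_lessI[OF Suc.prems(1)] Ck_lessI[OF Suc.prems(2)])
qed

lemma Ck_bounded_linear:
  assumes "bounded_linear l"
  shows "Ck k l"
proof (cases k)
  case 0
  then show ?thesis using assms by (simp add: linear_continuous_on)
next
  case (Suc j)
  show ?thesis unfolding Suc
    by (rule Ck_SucI[OF bounded_linear_imp_has_derivative[OF assms]]) (rule Ck_const)
qed

text \<open>The derivative \<open>L\<close> does not depend on the point, so the direction
  \<open>h\<close> is replaced by the fixed direction \<open>L h\<close> and the induction runs with
  the same map \<open>T\<close>.\<close>

lemma Ck_compose_affine:
  fixes T :: "'a::euclidean_space \<Rightarrow> 'b::euclidean_space"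
  assumes T: "\<And>z. (T has_derivative L) (at z)"
  shows "Ck k \<phi> \<Longrightarrow> Ck k (\<lambda>z. \<phi> (T z))"
proof (induction k arbitrary: \<phi>)
  case 0
  have "continuous_on UNIV T"
    using T by (meson continuous_at_imp_continuous_on has_derivative_continuous)
  with 0 show ?case by (auto intro: continuous_on_compose2)
next
  case (Suc k)
  show ?case
    by (rule Ck_SucI[OF has_derivative_compose[OF T Ck_SucD(1)[OF Suc.prems]]])
       (intro Suc.IH Ck_SucD(2)[OF Suc.prems])
qed

text \<open>A whole chain of successive derivatives is given, with \<open>j\<close> arbitrary in the
  induction, because each differentiation moves from \<open>D j\<close> to \<open>D (Suc j)\<close>
  and adds a factor from \<open>q\<close>.\<close>

lemma Ck_compose_real:
  fixes D :: "nat \<Rightarrow> real \<Rightarrow> real"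
  assumes D: "\<And>j s. (D j has_real_derivative D (Suc j) s) (at s)" and q: "smooth_fun q"
  shows "Ck k (\<lambda>z. D j (q z))"
proof (induction k arbitrary: j)
  case 0
  have "continuous_on UNIV (D j)"
    using D by (meson DERIV_isCont continuous_at_imp_continuous_on)
  moreover have "continuous_on UNIV q" using q unfolding smooth_fun_def by (metis Ck.simps(1))
  ultimately show ?case by (auto intro: continuous_on_compose2)
next
  case (Suc k)
  have q': "Ck (Suc k) q" using q by (simp only: smooth_fun_def)
  have d: "(D j has_derivative (\<lambda>x. D (Suc j) s * x)) (at s)" for s
    using D[of j s] by (simp add: has_field_derivative_def)
  show ?case
    by (rule Ck_SucI[OF has_derivative_compose[OF Ck_SucD(1)[OF q'] d]])
       (intro Ck_mult Suc.IH Ck_SucD(2)[OF q'])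
qed

lemma smooth_const: "smooth_fun (\<lambda>_. c)"
  and smooth_add: "smooth_fun \<phi> \<Longrightarrow> smooth_fun \<psi> \<Longrightarrow> smooth_fun (\<lambda>z. \<phi> z + \<psi> z)"
  and smooth_mult: "smooth_fun \<phi> \<Longrightarrow> smooth_fun \<psi> \<Longrightarrow> smooth_fun (\<lambda>z. \<phi> z * \<psi> z)"
  and smooth_bounded_linear: "bounded_linear l \<Longrightarrow> smooth_fun l"
  by (simp_all add: smooth_fun_def Ck_const Ck_add Ck_mult Ck_bounded_linear)

lemma smooth_sum:
  "finite I \<Longrightarrow> (\<And>i. i \<in> I \<Longrightarrow> smooth_fun (\<phi> i)) \<Longrightarrow> smooth_fun (\<lambda>z. \<Sum>i\<in>I. \<phi> i z)"
  by (induction I rule: finite_induct) (auto intro: smooth_const smooth_add)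

lemma smooth_inner:
  fixes l m :: "'a::euclidean_space \<Rightarrow> 'b::euclidean_space"
  assumes "bounded_linear l" "bounded_linear m"
  shows "smooth_fun (\<lambda>z. l z \<bullet> m z)"
proof -
  have "smooth_fun (\<lambda>z. (l z \<bullet> b) * (m z \<bullet> b))" for b
    by (intro smooth_mult smooth_bounded_linear bounded_linear_compose[OF bounded_linear_inner_left] assms)
  then show ?thesis
    by (subst euclidean_inner) (intro smooth_sum; simp)
qed

lemma smooth_diff:
  assumes "smooth_fun \<phi>" "smooth_fun \<psi>"
  shows "smooth_fun (\<lambda>z. \<phi> z - \<psi> z)"
  using smooth_add[OF assms(1) smooth_mult[OF smooth_const[of "-1"] assms(2)]] by simp

lemma smooth_continuous: "smooth_fun \<phi> \<Longrightarrow> continuous_on S \<phi>"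
  unfolding smooth_fun_def by (metis Ck.simps(1) continuous_on_subset subset_UNIV)

lemma smooth_has_derivative:
  "smooth_fun \<phi> \<Longrightarrow> (\<phi> has_derivative frechet_derivative \<phi> (at z)) (at z)"
  unfolding smooth_fun_def using Ck_SucD(1)[of 0] by blast

lemma smooth_frechet_derivative:
  "smooth_fun \<phi> \<Longrightarrow> smooth_fun (\<lambda>z. frechet_derivative \<phi> (at z) h)"
  unfolding smooth_fun_def using Ck_SucD(2) by blast

lemma smooth_compose_affine:
  fixes T :: "'a::euclidean_space \<Rightarrow> 'b::euclidean_space"
  assumes "\<And>z. (T has_derivative L) (at z)" "smooth_fun \<phi>"
  shows "smooth_fun (\<lambda>z. \<phi> (T z))"
  using assms Ck_compose_affine unfolding smooth_fun_def by blast

text \<open>All derivatives of \<open>exp (- 1 / s)\<close> are of the form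
  \<open>p (1 / s) * exp (- 1 / s)\<close> with a polynomial \<open>p\<close>.\<close>

definition flat :: "real poly \<Rightarrow> real \<Rightarrow> real" where
  "flat p s = (if s > 0 then poly p (1 / s) * exp (- (1 / s)) else 0)"

text \<open>With u = 1/s, d/ds is - u^2 d/du, which takes p(u) exp(-u) to u^2 (p(u) - p'(u))
  exp(-u); \<open>[:0, 0, 1:]\<close> is the polynomial u^2.\<close>

definition flat_step :: "real poly \<Rightarrow> real poly" where
  "flat_step p = [:0, 0, 1:] * (p - pderiv p)"

lemma poly_exp_tendsto_0: "((\<lambda>u. poly p u * exp (- u)) \<longlongrightarrow> (0::real)) at_top"
proof -
  have "((\<lambda>u. \<Sum>i\<le>degree p. coeff p i * (u ^ i / exp u)) \<longlongrightarrow> (\<Sum>i\<le>degree p. coeff p i * 0)) at_top"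
    by (intro tendsto_intros tendsto_power_div_exp_0)
  moreover have "(\<Sum>i\<le>degree p. coeff p i * (u ^ i / exp u)) = poly p u * exp (- u)" for u
    by (simp add: poly_altdef sum_distrib_right exp_minus field_simps sum_divide_distrib)
  ultimately show ?thesis by simp
qed

lemma flat_tendsto_0: "(flat p \<longlongrightarrow> 0) (at 0)"
proof -
  have "((\<lambda>s. poly p (inverse s) * exp (- inverse s)) \<longlongrightarrow> 0) (at_right (0::real))"
    by (rule filterlim_compose[OF poly_exp_tendsto_0 filterlim_inverse_at_top_right])
  then have "(flat p \<longlongrightarrow> 0) (at_right 0)"
    by (rule Lim_transform_eventually)
       (auto simp: flat_def eventually_at_right_field inverse_eq_divide intro!: exI[of _ 1])
  moreover have "(flat p \<longlongrightarrow> 0) (at_left 0)"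
    by (rule tendsto_eventually) (auto simp: flat_def eventually_at_left_field intro!: exI[of _ "-1"])
  ultimately show ?thesis by (simp add: filterlim_split_at)
qed

lemma flat_deriv: "(flat p has_real_derivative flat (flat_step p) s) (at s)"
proof (cases "s = 0")
  case True
  \<comment> \<open>The difference quotient at 0 is flat again: dividing by h multiplies the
    polynomial by u = 1/h, hence \<open>[:0, 1:] * p\<close>.\<close>
  have "((\<lambda>h. flat p h / h) \<longlongrightarrow> 0) (at 0)"
    by (rule Lim_transform_eventually[OF flat_tendsto_0[of "[:0, 1:] * p"]])
       (auto simp: flat_def eventually_at_topological)
  then show ?thesis using True by (simp add: DERIV_def flat_def)
next
  case False
  show ?thesis
  proof (cases "s > 0")
    case True
    have *: "((\<lambda>s. poly p (1 / s) * exp (- (1 / s))) has_real_derivative flat (flat_step p) s) (at s)"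
      using True unfolding flat_def flat_step_def
      by (auto intro!: derivative_eq_intros DERIV_chain2[OF poly_DERIV]
          simp: field_simps power2_eq_square)
    have ev: "\<forall>\<^sub>F x in nhds s. poly p (1 / x) * exp (- (1 / x)) = flat p x"
      unfolding eventually_nhds by (rule exI[of _ "{0<..}"]) (use True in \<open>auto simp: flat_def\<close>)
    show ?thesis using * DERIV_cong_ev[OF refl ev refl] by blast
  next
    case False
    have ev: "\<forall>\<^sub>F x in nhds s. 0 = flat p x"
      unfolding eventually_nhds by (rule exI[of _ "{..<0}"]) (use False \<open>s \<noteq> 0\<close> in \<open>auto simp: flat_def\<close>)
    have "((\<lambda>x. 0) has_real_derivative flat (flat_step p) s) (at s)"
      using False by (auto simp: flat_def)
    then show ?thesis using DERIV_cong_ev[OF refl ev refl] by blast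
  qed
qed

lemma smooth_flat:
  assumes "smooth_fun q"
  shows "smooth_fun (\<lambda>z. flat p (q z))"
  unfolding smooth_fun_def
  using Ck_compose_real[of "\<lambda>j. flat ((flat_step ^^ j) p)" q _ 0] flat_deriv assms by auto

section \<open>Kinetic dilations and Lebesgue measure\<close>

text \<open>\<open>mv z r w = z \<circ> \<delta> r w\<close>, and \<open>mv_inv z r\<close> is its inverse as a map of \<open>w\<close>.\<close>

definition mv :: "'n::finite phase \<Rightarrow> real \<Rightarrow> 'n phase \<Rightarrow> 'n phase" where
  "mv z r w = (fst z + r^2 * fst w,
     fst (snd z) + r^3 *\<^sub>R fst (snd w) + (r^2 * fst w) *\<^sub>R snd (snd z),
     snd (snd z) + r *\<^sub>R snd (snd w))"

definition mv_inv :: "'n::finite phase \<Rightarrow> real \<Rightarrow> 'n phase \<Rightarrow> 'n phase" where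
  "mv_inv z r u = ((1/r^2) * (fst u - fst z),
     (1/r^3) *\<^sub>R (fst (snd u) - fst (snd z) - (fst u - fst z) *\<^sub>R snd (snd z)),
     (1/r) *\<^sub>R (snd (snd u) - snd (snd z)))"

text \<open>The homogeneous dimension: \<delta> r has Jacobian r^2 in time, r^(3 n) in position and
  r^n in velocity.\<close>

abbreviation hdim :: "'n::finite itself \<Rightarrow> nat" where
  "hdim _ \<equiv> 4 * CARD('n) + 2"

lemma mv_mv_inv: "r > 0 \<Longrightarrow> mv z r (mv_inv z r u) = u"
  and mv_inv_mv: "r > 0 \<Longrightarrow> mv_inv z r (mv z r w) = w"
  by (simp_all add: mv_def mv_inv_def prod_eq_iff)

lemma continuous_on_mv: "continuous_on A (mv z r)"
  unfolding mv_def[abs_def] by (intro continuous_intros)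

lemma mv_measurable [measurable (raw)]:
  fixes z w :: "'a \<Rightarrow> 'n::finite phase"
  assumes [measurable]: "z \<in> borel_measurable M" "r \<in> borel_measurable M" "w \<in> borel_measurable M"
  shows "(\<lambda>x. mv (z x) (r x) (w x)) \<in> borel_measurable M"
    "(\<lambda>x. mv_inv (z x) (r x) (w x)) \<in> borel_measurable M"
proof -
  have c: "fst \<in> borel_measurable (borel :: 'n phase measure)"
    "(\<lambda>p. fst (snd p)) \<in> borel_measurable (borel :: 'n phase measure)"
    "(\<lambda>p. snd (snd p)) \<in> borel_measurable (borel :: 'n phase measure)"
    by (auto intro!: borel_measurable_continuous_onI continuous_intros)
  note m = measurable_compose[OF assms(1) c(1)] measurable_compose[OF assms(1) c(2)]
    measurable_compose[OF assms(1) c(3)] measurable_compose[OF assms(3) c(1)]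
    measurable_compose[OF assms(3) c(2)] measurable_compose[OF assms(3) c(3)]
  note i = borel_measurable_Pair borel_measurable_add borel_measurable_scaleR borel_measurable_times
    borel_measurable_power borel_measurable_diff borel_measurable_divide borel_measurable_const
  show "(\<lambda>x. mv (z x) (r x) (w x)) \<in> borel_measurable M"
    unfolding mv_def by (intro i m assms)
  show "(\<lambda>x. mv_inv (z x) (r x) (w x)) \<in> borel_measurable M"
    unfolding mv_inv_def by (intro i m assms)
qed

text \<open>The order with x innermost serves translations that shift x by a multiple of v: for
  fixed v this shift is a constant.\<close>

lemma nn_integral_phase:
  fixes F :: "'n::finite phase \<Rightarrow> ennreal"
  assumes [measurable]: "F \<in> borel_measurable borel"
  shows "(\<integral>\<^sup>+z. F z \<partial>lborel) = (\<integral>\<^sup>+t. \<integral>\<^sup>+x. \<integral>\<^sup>+v. F (t, x, v) \<partial>lborel \<partial>lborel \<partial>lborel)"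
    and "(\<integral>\<^sup>+z. F z \<partial>lborel) = (\<integral>\<^sup>+t. \<integral>\<^sup>+v. \<integral>\<^sup>+x. F (t, x, v) \<partial>lborel \<partial>lborel \<partial>lborel)"
proof -
  have [measurable]: "F \<in> borel_measurable (borel \<Otimes>\<^sub>M (borel \<Otimes>\<^sub>M borel))"
    using assms by (simp add: borel_prod)
  have "(\<integral>\<^sup>+z. F z \<partial>lborel) = (\<integral>\<^sup>+z. F z \<partial>(lborel \<Otimes>\<^sub>M lborel))"
    by (simp add: lborel_prod)
  also have "\<dots> = (\<integral>\<^sup>+t. \<integral>\<^sup>+y. F (t, y) \<partial>lborel \<partial>lborel)"
    by (rule lborel.nn_integral_fst[symmetric]) (simp add: lborel_prod)
  finally have *: "(\<integral>\<^sup>+z. F z \<partial>lborel) = (\<integral>\<^sup>+t. \<integral>\<^sup>+y. F (t, y) \<partial>lborel \<partial>lborel)" .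
  have **: "(\<integral>\<^sup>+y. F (t, y) \<partial>lborel) = (\<integral>\<^sup>+x. \<integral>\<^sup>+v. F (t, x, v) \<partial>lborel \<partial>lborel)" for t
  proof -
    have "(\<integral>\<^sup>+y. F (t, y) \<partial>lborel) = (\<integral>\<^sup>+y. F (t, y) \<partial>(lborel \<Otimes>\<^sub>M lborel))"
      by (simp add: lborel_prod)
    also have "\<dots> = (\<integral>\<^sup>+x. \<integral>\<^sup>+v. F (t, x, v) \<partial>lborel \<partial>lborel)"
      by (rule lborel.nn_integral_fst[symmetric]) measurable
    finally show ?thesis .
  qed
  show "(\<integral>\<^sup>+z. F z \<partial>lborel) = (\<integral>\<^sup>+t. \<integral>\<^sup>+x. \<integral>\<^sup>+v. F (t, x, v) \<partial>lborel \<partial>lborel \<partial>lborel)"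
    unfolding * ** ..
  moreover have "(\<integral>\<^sup>+x. \<integral>\<^sup>+v. F (t, x, v) \<partial>lborel \<partial>lborel) = (\<integral>\<^sup>+v. \<integral>\<^sup>+x. F (t, x, v) \<partial>lborel \<partial>lborel)" for t
    by (rule lborel_pair.Fubini'[symmetric]) measurable
  ultimately show "(\<integral>\<^sup>+z. F z \<partial>lborel) = (\<integral>\<^sup>+t. \<integral>\<^sup>+v. \<integral>\<^sup>+x. F (t, x, v) \<partial>lborel \<partial>lborel \<partial>lborel)"
    by simp
qed

section \<open>Lebesgue measure under kinetic translations and dilations\<close>

lemma nn_integral_affine:
  fixes F :: "'a::euclidean_space \<Rightarrow> ennreal"
  assumes [measurable]: "F \<in> borel_measurable borel" and c: "c \<noteq> 0"
  shows "(\<integral>\<^sup>+x. F (a + c *\<^sub>R x) \<partial>lborel) = ennreal (1 / \<bar>c\<bar> ^ DIM('a)) * (\<integral>\<^sup>+x. F x \<partial>lborel)"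
proof -
  have "(\<integral>\<^sup>+x. F x \<partial>lborel) = ennreal (\<bar>c\<bar> ^ DIM('a)) * (\<integral>\<^sup>+x. F (a + c *\<^sub>R x) \<partial>lborel)"
    by (subst lborel_affine[OF c, of a]) (simp add: nn_integral_density nn_integral_distr nn_integral_cmult)
  then show ?thesis
    using c by (simp add: mult.assoc[symmetric] ennreal_mult[symmetric])
qed

lemma nn_integral_translate:
  fixes F :: "'a::euclidean_space \<Rightarrow> ennreal"
  assumes "F \<in> borel_measurable borel"
  shows "(\<integral>\<^sup>+x. F (x + a) \<partial>lborel) = (\<integral>\<^sup>+x. F x \<partial>lborel)"
  using nn_integral_affine[OF assms, of 1 a] by (simp add: add.commute)

text \<open>In \<open>w\<close> the map is a dilation followed by a left translation. Integrating
  over velocity, position and time in turn, each shift depends only on variables still held fixed,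
  and the Jacobians r^n, r^(3 n), r^2 multiply.\<close>

lemma nn_integral_mv_right:
  fixes F :: "'n::finite phase \<Rightarrow> ennreal"
  assumes F [measurable]: "F \<in> borel_measurable borel" and r: "r > 0"
  shows "(\<integral>\<^sup>+w. F (mv z r w) \<partial>lborel) = ennreal (1 / r ^ hdim TYPE('n)) * (\<integral>\<^sup>+z. F z \<partial>lborel)"
proof -
  obtain t x v where z: "z = (t, x, v)" by (cases z) auto
  have [measurable]: "F \<in> borel_measurable (borel \<Otimes>\<^sub>M (borel \<Otimes>\<^sub>M borel))"
    using assms by (simp add: borel_prod)
  have "(\<integral>\<^sup>+w. F (mv z r w) \<partial>lborel) =
     (\<integral>\<^sup>+s. \<integral>\<^sup>+y. \<integral>\<^sup>+w. F (t + r^2 * s, x + r^3 *\<^sub>R y + (r^2 * s) *\<^sub>R v, v + r *\<^sub>R w) \<partial>lborel \<partial>lborel \<partial>lborel)"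
    by (subst nn_integral_phase(1)[where F="\<lambda>w. F (mv z r w)"]) (measurable, simp add: mv_def z)
  also have "\<dots> = (\<integral>\<^sup>+s. \<integral>\<^sup>+y. ennreal (1 / r ^ CARD('n)) * (\<integral>\<^sup>+w. F (t + r^2 * s, x + r^3 *\<^sub>R y + (r^2 * s) *\<^sub>R v, w) \<partial>lborel) \<partial>lborel \<partial>lborel)"
    using r by (subst nn_integral_affine) auto
  also have "\<dots> = (\<integral>\<^sup>+s. \<integral>\<^sup>+y. ennreal (1 / r ^ CARD('n)) * (\<integral>\<^sup>+w. F (t + r^2 * s, (x + (r^2 * s) *\<^sub>R v) + r^3 *\<^sub>R y, w) \<partial>lborel) \<partial>lborel \<partial>lborel)"
    by (simp add: algebra_simps)
  also have "\<dots> = (\<integral>\<^sup>+s. ennreal (1 / (r^3) ^ CARD('n)) * (\<integral>\<^sup>+y. ennreal (1 / r ^ CARD('n)) * (\<integral>\<^sup>+w. F (t + r^2 * s, y, w) \<partial>lborel) \<partial>lborel) \<partial>lborel)"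
    using r by (subst nn_integral_affine[where c="r^3"]) auto
  also have "\<dots> = ennreal (1 / r^2) * (\<integral>\<^sup>+s. ennreal (1 / (r^3) ^ CARD('n)) * (\<integral>\<^sup>+y. ennreal (1 / r ^ CARD('n)) * (\<integral>\<^sup>+w. F (s, y, w) \<partial>lborel) \<partial>lborel) \<partial>lborel)"
    using r nn_integral_affine[where c="r^2" and 'a=real and a=t and
        F="\<lambda>s. ennreal (1 / (r^3) ^ CARD('n)) * (\<integral>\<^sup>+y. ennreal (1 / r ^ CARD('n)) * (\<integral>\<^sup>+w. F (s, y, w) \<partial>lborel) \<partial>lborel)"]
    by simp
  also have "\<dots> = ennreal (1 / r^2) * (ennreal (1 / (r^3) ^ CARD('n)) * (ennreal (1 / r ^ CARD('n)) * (\<integral>\<^sup>+s. \<integral>\<^sup>+y. \<integral>\<^sup>+w. F (s, y, w) \<partial>lborel \<partial>lborel \<partial>lborel)))"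
    by (simp add: nn_integral_cmult)
  also have "\<dots> = ennreal (1 / r ^ hdim TYPE('n)) * (\<integral>\<^sup>+z. F z \<partial>lborel)"
    using r by (simp add: nn_integral_phase(1) mult.assoc[symmetric] ennreal_mult[symmetric] power_mult[symmetric] power_add[symmetric] add.commute)
  finally show ?thesis .
qed

text \<open>In \<open>z\<close> the map is a right translation, a shear of determinant 1;
  \<open>r\<close> enters only through the translating element \<delta> r w.\<close>

lemma nn_integral_mv_left:
  fixes F :: "'n::finite phase \<Rightarrow> ennreal"
  assumes F [measurable]: "F \<in> borel_measurable borel"
  shows "(\<integral>\<^sup>+z. F (mv z r w) \<partial>lborel) = (\<integral>\<^sup>+z. F z \<partial>lborel)"
proof -
  obtain s y w' where w: "w = (s, y, w')" by (cases w) auto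
  have [measurable]: "F \<in> borel_measurable (borel \<Otimes>\<^sub>M (borel \<Otimes>\<^sub>M borel))"
    using assms by (simp add: borel_prod)
  have "(\<integral>\<^sup>+z. F (mv z r w) \<partial>lborel) =
     (\<integral>\<^sup>+t. \<integral>\<^sup>+v. \<integral>\<^sup>+x. F (t + r^2 * s, x + (r^3 *\<^sub>R y + (r^2 * s) *\<^sub>R v), v + r *\<^sub>R w') \<partial>lborel \<partial>lborel \<partial>lborel)"
    by (subst nn_integral_phase(2)[where F="\<lambda>z. F (mv z r w)"]) (measurable, simp add: mv_def w add.assoc)
  also have "\<dots> = (\<integral>\<^sup>+t. \<integral>\<^sup>+v. \<integral>\<^sup>+x. F (t + r^2 * s, x, v + r *\<^sub>R w') \<partial>lborel \<partial>lborel \<partial>lborel)"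
    by (subst nn_integral_translate[where F="\<lambda>x. F (_, x, _)"]) auto
  also have "\<dots> = (\<integral>\<^sup>+t. \<integral>\<^sup>+v. \<integral>\<^sup>+x. F (t + r^2 * s, x, v) \<partial>lborel \<partial>lborel \<partial>lborel)"
    by (subst nn_integral_translate[where F="\<lambda>v. \<integral>\<^sup>+x. F (_, x, v) \<partial>lborel"]) auto
  also have "\<dots> = (\<integral>\<^sup>+t. \<integral>\<^sup>+v. \<integral>\<^sup>+x. F (t, x, v) \<partial>lborel \<partial>lborel \<partial>lborel)"
    by (subst nn_integral_translate[where F="\<lambda>t. \<integral>\<^sup>+v. \<integral>\<^sup>+x. F (t, x, v) \<partial>lborel \<partial>lborel"]) auto
  finally show ?thesis by (simp add: nn_integral_phase(2))
qed

lemma distr_mv: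
  fixes z :: "'n::finite phase"
  assumes r: "r > 0"
  shows "distr lborel borel (mv z r) = density lborel (\<lambda>_. ennreal (1 / r ^ hdim TYPE('n)))"
proof (rule measure_eqI)
  fix A assume "A \<in> sets (distr lborel borel (mv z r))"
  then have [measurable]: "A \<in> sets borel" by simp
  have "emeasure (distr lborel borel (mv z r)) A = (\<integral>\<^sup>+w. indicator A (mv z r w) \<partial>lborel)"
    by (subst nn_integral_indicator[symmetric], simp, subst nn_integral_distr) auto
  also have "\<dots> = ennreal (1 / r ^ hdim TYPE('n)) * (\<integral>\<^sup>+z. indicator A z \<partial>lborel)"
    by (rule nn_integral_mv_right[OF _ r]) measurable
  also have "\<dots> = emeasure (density lborel (\<lambda>_. ennreal (1 / r ^ hdim TYPE('n)))) A"
    by (simp add: emeasure_density nn_integral_cmult)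
  finally show "emeasure (distr lborel borel (mv z r)) A = \<dots>" .
qed simp

lemma
  fixes F :: "'n::finite phase \<Rightarrow> real"
  assumes F [measurable]: "F \<in> borel_measurable borel" and r: "r > 0"
  shows integral_mv: "(LINT w|lborel. F (mv z r w)) = (1 / r ^ hdim TYPE('n)) * (LINT z|lborel. F z)"
    and integrable_mv: "integrable lborel (\<lambda>w. F (mv z r w)) \<longleftrightarrow> integrable lborel F"
proof -
  have "(LINT w|lborel. F (mv z r w)) = integral\<^sup>L (distr lborel borel (mv z r)) F"
    by (subst integral_distr) auto
  also have "\<dots> = (1 / r ^ hdim TYPE('n)) * (LINT z|lborel. F z)"
    unfolding distr_mv[OF r] using r by (subst integral_density) auto
  finally show "(LINT w|lborel. F (mv z r w)) = (1 / r ^ hdim TYPE('n)) * (LINT z|lborel. F z)" .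
  have "integrable lborel (\<lambda>w. F (mv z r w)) \<longleftrightarrow> integrable (distr lborel borel (mv z r)) F"
    by (subst integrable_distr_eq) auto
  also have "\<dots> \<longleftrightarrow> integrable lborel (\<lambda>w. (1 / r ^ hdim TYPE('n)) * F w)"
    unfolding distr_mv[OF r] using r by (subst integrable_density) auto
  also have "\<dots> \<longleftrightarrow> integrable lborel F"
    using r by (subst integrable_mult_left_iff) simp
  finally show "integrable lborel (\<lambda>w. F (mv z r w)) \<longleftrightarrow> integrable lborel F" .
qed

section \<open>The weak equations on kinetic balls\<close>

definition kin_deriv :: "('n::finite phase \<Rightarrow> real) \<Rightarrow> 'n phase \<Rightarrow> real" where
  "kin_deriv \<phi> z = dt \<phi> z + transport \<phi> z"

lemma kin_deriv_eq:
  assumes "smooth_fun \<phi>"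
  shows "kin_deriv \<phi> z = frechet_derivative \<phi> (at z) (1, snd (snd z), 0)"
proof -
  interpret l: bounded_linear "frechet_derivative \<phi> (at z)"
    using smooth_has_derivative[OF assms] by (rule has_derivative_bounded_linear)
  show ?thesis
    unfolding kin_deriv_def dt_def transport_def l.add[symmetric] by simp
qed

text \<open>The direction of differentiation varies with the point, so v is expanded in coordinates
  and each term is a coordinate of v times a derivative in a fixed direction.\<close>

lemma transport_smooth:
  fixes \<phi> :: "'n::finite phase \<Rightarrow> real"
  assumes "smooth_fun \<phi>"
  shows "smooth_fun (transport \<phi>)"
proof -
  have *: "transport \<phi> z = (\<Sum>i\<in>UNIV. (snd (snd z) $ i) * frechet_derivative \<phi> (at z) (0, axis i 1, 0))" for z
  proof -
    interpret l: bounded_linear "frechet_derivative \<phi> (at z)"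
      using smooth_has_derivative[OF assms] by (rule has_derivative_bounded_linear)
    have "(0, snd (snd z), 0) = (\<Sum>i\<in>UNIV. (snd (snd z) $ i) *\<^sub>R (0, axis i 1, 0) :: 'n phase)"
      using basis_expansion[of "snd (snd z)"]
      by (simp add: prod_eq_iff fst_sum snd_sum scalar_mult_eq_scaleR)
    then show ?thesis
      unfolding transport_def by (simp only: l.sum l.scaleR real_scaleR_def)
  qed
  show ?thesis
    unfolding * [abs_def]
    by (intro smooth_sum smooth_mult smooth_frechet_derivative assms smooth_bounded_linear
        bounded_linear_compose[OF bounded_linear_vec_nth] bounded_linear_compose[OF bounded_linear_snd] bounded_linear_snd) simp
qed

lemma smooth_derivs:
  assumes "smooth_fun \<phi>"
  shows "smooth_fun (dt \<phi>)" "smooth_fun (dv \<phi> i)" "smooth_fun (kin_deriv \<phi>)"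
  using smooth_frechet_derivative[OF assms] transport_smooth[OF assms]
  unfolding dt_def[abs_def] dv_def[abs_def] kin_deriv_def[abs_def] by (auto intro!: smooth_add)

lemma smooth_measurable: "smooth_fun \<phi> \<Longrightarrow> \<phi> \<in> borel_measurable borel"
  by (intro borel_measurable_continuous_onI smooth_continuous)

lemma grad_v_measurable:
  fixes \<phi> :: "'n::finite phase \<Rightarrow> real"
  assumes "smooth_fun \<phi>"
  shows "grad_v \<phi> \<in> borel_measurable borel"
  unfolding grad_v_def[abs_def]
  by (intro borel_measurable_continuous_onI continuous_on_vec_lambda smooth_continuous smooth_derivs assms)

text \<open>The linear part of the affine map \<open>mv_inv z r\<close>, hence its derivative at
  every point.\<close>

definition mv_inv_lin :: "'n::finite phase \<Rightarrow> real \<Rightarrow> 'n phase \<Rightarrow> 'n phase" where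
  "mv_inv_lin z r h = ((1/r^2) * fst h, (1/r^3) *\<^sub>R (fst (snd h) - fst h *\<^sub>R snd (snd z)), (1/r) *\<^sub>R snd (snd h))"

lemma mv_inv_has_derivative: "(mv_inv z r has_derivative mv_inv_lin z r) (at u)"
proof -
  have "((\<lambda>u. (a * (fst u - fst z), b *\<^sub>R (fst (snd u) - fst (snd z) - (fst u - fst z) *\<^sub>R snd (snd z)),
      c *\<^sub>R (snd (snd u) - snd (snd z)))) has_derivative
    (\<lambda>h. (a * fst h, b *\<^sub>R (fst (snd h) - fst h *\<^sub>R snd (snd z)), c *\<^sub>R snd (snd h)))) (at u)" for a b c
    by (auto intro!: derivative_eq_intros)
  then show ?thesis
    unfolding mv_inv_def[abs_def] mv_inv_lin_def[abs_def] .
qed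

lemma test_fun_mv_inv:
  assumes "test_fun \<phi>" and r: "r > 0"
  shows "test_fun (\<lambda>u. \<phi> (mv_inv z r u))"
proof -
  have "smooth_fun (\<lambda>u. \<phi> (mv_inv z r u))"
    by (rule smooth_compose_affine[OF mv_inv_has_derivative]) (use assms(1) in \<open>simp add: test_fun_def\<close>)
  moreover have "compact (closure {u. \<phi> (mv_inv z r u) \<noteq> 0})"
  proof -
    have "{u. \<phi> (mv_inv z r u) \<noteq> 0} \<subseteq> mv z r ` closure {w. \<phi> w \<noteq> 0}"
      using mv_mv_inv[OF r] closure_subset by (smt (verit) image_iff mem_Collect_eq subset_eq)
    moreover have "compact (mv z r ` closure {w. \<phi> w \<noteq> 0})"
      using assms(1) by (intro compact_continuous_image continuous_on_mv) (auto simp: test_fun_def)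
    ultimately show ?thesis
      by (meson bounded_subset compact_closure compact_imp_bounded)
  qed
  ultimately show ?thesis by (simp add: test_fun_def)
qed

lemma derivs_mv_inv:
  fixes \<phi> :: "'n::finite phase \<Rightarrow> real" and z :: "'n phase"
  assumes "smooth_fun \<phi>" and r: "r > 0"
  defines "\<phi>' \<equiv> \<lambda>u. \<phi> (mv_inv z r u)"
  shows "dv \<phi>' i u = (1 / r) * dv \<phi> i (mv_inv z r u)"
    and "dt \<phi>' u + transport \<phi>' u = (1 / r^2) * kin_deriv \<phi> (mv_inv z r u)"
    and "grad_v \<phi>' u = (1 / r) *\<^sub>R grad_v \<phi> (mv_inv z r u)"
proof -
  have s': "smooth_fun \<phi>'"
    unfolding \<phi>'_def using smooth_compose_affine[OF mv_inv_has_derivative assms(1)] .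
  have d: "frechet_derivative \<phi>' (at u) h = frechet_derivative \<phi> (at (mv_inv z r u)) (mv_inv_lin z r h)" for h
    unfolding \<phi>'_def
    using frechet_derivative_at[OF has_derivative_compose[OF mv_inv_has_derivative smooth_has_derivative[OF assms(1)]]]
    by metis
  interpret l: bounded_linear "frechet_derivative \<phi> (at (mv_inv z r u))"
    using smooth_has_derivative[OF assms(1)] by (rule has_derivative_bounded_linear)
  have "mv_inv_lin z r (0, 0, axis i 1) = (1 / r) *\<^sub>R (0, 0, axis i 1)" for i
    by (simp add: mv_inv_lin_def)
  then show dv: "dv \<phi>' i u = (1 / r) * dv \<phi> i (mv_inv z r u)" for i
    unfolding dv_def d by (simp only: l.scaleR real_scaleR_def)
  show "grad_v \<phi>' u = (1 / r) *\<^sub>R grad_v \<phi> (mv_inv z r u)"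
    unfolding grad_v_def dv by (simp add: vec_eq_iff)
  \<comment> \<open>Left invariance of the kinetic field: the shear in \<open>mv_inv_lin\<close>
    subtracts the velocity of \<open>z\<close>, and (v(u) - v(z)) / r^3 is 1/r^2 times the rescaled
    velocity.\<close>
  have "mv_inv_lin z r (1, snd (snd u), 0) = (1 / r^2) *\<^sub>R (1, snd (snd (mv_inv z r u)), 0)"
    using r by (simp add: mv_inv_lin_def mv_inv_def field_simps power2_eq_square power3_eq_cube)
  then show "dt \<phi>' u + transport \<phi>' u = (1 / r^2) * kin_deriv \<phi> (mv_inv z r u)"
    unfolding kin_deriv_def[of \<phi>', symmetric] kin_deriv_eq[OF s'] kin_deriv_eq[OF assms(1)] d
    by (simp only: l.scaleR real_scaleR_def)
qed

text \<open>The pulled back test function costs 1/r^2 on the kinetic side and 1/r on the gradient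
  side, while the Jacobian is common to both; what remains is one factor \<open>r\<close>.\<close>

lemma kinetic_eq_mv:
  fixes f :: "'n::finite phase \<Rightarrow> real"
  assumes [measurable]: "f \<in> borel_measurable borel" "S \<in> borel_measurable borel"
    and "kinetic_eq f S" "test_fun \<phi>" and r: "r > 0"
  shows "(LINT w|lborel. f (mv z r w) * kin_deriv \<phi> w) = r * (LINT w|lborel. S (mv z r w) \<bullet> grad_v \<phi> w)"
proof -
  have s: "smooth_fun \<phi>" using assms by (simp add: test_fun_def)
  note [measurable] = smooth_measurable[OF smooth_derivs(3)[OF s]] grad_v_measurable[OF s]
  let ?c = "1 / r ^ hdim TYPE('n)"
  have "(LINT u|lborel. f u * ((1 / r^2) * kin_deriv \<phi> (mv_inv z r u))) = (LINT u|lborel. S u \<bullet> ((1 / r) *\<^sub>R grad_v \<phi> (mv_inv z r u)))"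
    using assms(3) test_fun_mv_inv[OF assms(4) r, of z]
    unfolding kinetic_eq_def derivs_mv_inv[OF s r, symmetric] by blast
  then have "?c * (LINT u|lborel. f u * ((1 / r^2) * kin_deriv \<phi> (mv_inv z r u))) = ?c * (LINT u|lborel. S u \<bullet> ((1 / r) *\<^sub>R grad_v \<phi> (mv_inv z r u)))"
    by simp
  then have "(LINT w|lborel. f (mv z r w) * ((1 / r^2) * kin_deriv \<phi> w)) = (LINT w|lborel. S (mv z r w) \<bullet> ((1 / r) *\<^sub>R grad_v \<phi> w))"
    by (subst (asm) (1 2) integral_mv[OF _ r, symmetric, of _ z]) (simp_all add: mv_inv_mv[OF r])
  moreover have "(LINT w|lborel. f (mv z r w) * ((1 / r^2) * kin_deriv \<phi> w)) = (1 / r^2) * (LINT w|lborel. f (mv z r w) * kin_deriv \<phi> w)"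
    by (subst integral_mult_right_zero[symmetric]) (simp add: ac_simps)
  moreover have "(LINT w|lborel. S (mv z r w) \<bullet> ((1 / r) *\<^sub>R grad_v \<phi> w)) = (1 / r) * (LINT w|lborel. S (mv z r w) \<bullet> grad_v \<phi> w)"
    by (subst integral_mult_right_zero[symmetric]) simp
  ultimately show ?thesis
    using r by (simp add: field_simps power2_eq_square)
qed

text \<open>Here only one side carries a derivative, so its factor 1/r alone survives, with the sign
  of integration by parts.\<close>

lemma weak_grad_v_mv:
  fixes f :: "'n::finite phase \<Rightarrow> real"
  assumes [measurable]: "f \<in> borel_measurable borel" "g \<in> borel_measurable borel"
    and "weak_grad_v f g" "test_fun \<phi>" and r: "r > 0"
  shows "(LINT w|lborel. f (mv z r w) * dv \<phi> i w) = - r * (LINT w|lborel. (g (mv z r w) $ i) * \<phi> w)"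
proof -
  have s: "smooth_fun \<phi>" using assms by (simp add: test_fun_def)
  note [measurable] = smooth_measurable[OF smooth_derivs(2)[OF s]] smooth_measurable[OF s]
  have [measurable]: "(\<lambda>z. g z $ i) \<in> borel_measurable borel"
    by (rule measurable_compose[OF assms(2)]) (intro borel_measurable_continuous_onI continuous_intros)
  let ?c = "1 / r ^ hdim TYPE('n)"
  have "(LINT u|lborel. f u * ((1 / r) * dv \<phi> i (mv_inv z r u))) = - (LINT u|lborel. (g u $ i) * \<phi> (mv_inv z r u))"
    using assms(3) test_fun_mv_inv[OF assms(4) r, of z]
    unfolding weak_grad_v_def derivs_mv_inv(1)[OF s r, symmetric] by blast
  then have "?c * (LINT u|lborel. f u * ((1 / r) * dv \<phi> i (mv_inv z r u))) = - (?c * (LINT u|lborel. (g u $ i) * \<phi> (mv_inv z r u)))"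
    by simp
  then have "(LINT w|lborel. f (mv z r w) * ((1 / r) * dv \<phi> i w)) = - (LINT w|lborel. (g (mv z r w) $ i) * \<phi> w)"
    by (subst (asm) (1 2) integral_mv[OF _ r, symmetric, of _ z]) (simp_all add: mv_inv_mv[OF r])
  moreover have "(LINT w|lborel. f (mv z r w) * ((1 / r) * dv \<phi> i w)) = (1 / r) * (LINT w|lborel. f (mv z r w) * dv \<phi> i w)"
    by (subst integral_mult_right_zero[symmetric]) (simp add: ac_simps)
  ultimately show ?thesis
    using r by (simp add: field_simps)
qed

section \<open>Decomposition of the dilation derivative\<close>

text \<open>\<open>bump 1\<close> is exp (-1 / (1 - |z|^2)) inside the unit ball; the parameter
  \<open>p\<close> makes the family closed under differentiation up to factors linear in
  \<open>z\<close>.\<close>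

definition bump :: "real poly \<Rightarrow> 'n::finite phase \<Rightarrow> real" where
  "bump p z = flat p (1 - z \<bullet> z)"

lemma bump_smooth: "smooth_fun (bump p)"
  unfolding bump_def[abs_def]
  by (intro smooth_flat smooth_diff smooth_const smooth_inner bounded_linear_ident)

lemma bump_outside: "norm z > 1 \<Longrightarrow> bump p z = 0"
  by (simp add: bump_def flat_def norm_eq_sqrt_inner)

lemma bump_has_derivative:
  "(bump p has_derivative (\<lambda>h. bump (flat_step p) z * (- 2 * (z \<bullet> h)))) (at z)"
proof -
  have "(flat p has_derivative (\<lambda>x. flat (flat_step p) (1 - z \<bullet> z) * x)) (at (1 - z \<bullet> z))"
    using flat_deriv by (simp add: has_field_derivative_def)
  moreover have "((\<lambda>z. 1 - z \<bullet> z) has_derivative (\<lambda>h. - 2 * (z \<bullet> h))) (at z)"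
    by (auto intro!: derivative_eq_intros simp: inner_commute)
  ultimately show ?thesis
    unfolding bump_def[abs_def] using has_derivative_compose[of "\<lambda>z. 1 - z \<bullet> z"] by fast
qed

text \<open>\<open>profile\<close> is the divergence of \<open>bump 1\<close> times the dilation generator \<open>(2 s, 3 y, w)\<close>.
  Modulo \<open>\<partial>\<^sub>s + w \<cdot> \<nabla>\<^sub>y\<close> and \<open>\<nabla>\<^sub>w\<close> of compactly supported terms it is \<open>\<nabla>\<^sub>y \<cdot> G\<close> with
  \<open>G = (3 y - 2 s w) bump 1\<close>, and the commutator identity
  \<open>\<partial>\<^bsub>y i\<^esub> = [\<partial>\<^bsub>w i\<^esub>, \<partial>\<^sub>s + w \<cdot> \<nabla>\<^sub>y]\<close> turns this into the potentials \<open>potA\<close> and \<open>potB\<close>.\<close>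

definition profile :: "'n::finite phase \<Rightarrow> real" where
  "profile z = (4 * real CARD('n) + 2) * bump 1 z
     - 2 * bump (flat_step 1) z * (2 * (fst z * fst z) + 3 * (fst (snd z) \<bullet> fst (snd z)) + snd (snd z) \<bullet> snd (snd z))"

definition potA :: "'n::finite phase \<Rightarrow> real" where
  "potA z = (2 + 2 * real CARD('n)) * (fst z * bump 1 z)
     + 2 * (bump (flat_step 1) z * (3 * (fst (snd z) \<bullet> snd (snd z)) - 2 * (fst z * (snd (snd z) \<bullet> snd (snd z)))))"

definition potB :: "'n \<Rightarrow> 'n::finite phase \<Rightarrow> real" where
  "potB i z = 2 * ((snd (snd z) \<bullet> axis i 1) * bump 1 z)
     - 2 * ((3 * (fst (snd z) \<bullet> axis i 1) - 2 * (fst z * (snd (snd z) \<bullet> axis i 1))) * bump (flat_step 1) z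
          * (fst z + snd (snd z) \<bullet> fst (snd z)))"

lemma smooth_coords:
  shows "smooth_fun (\<lambda>z :: 'n::finite phase. fst z)"
    "smooth_fun (\<lambda>z :: 'n phase. fst (snd z) \<bullet> a)" "smooth_fun (\<lambda>z :: 'n phase. snd (snd z) \<bullet> a)"
    "smooth_fun (\<lambda>z :: 'n phase. fst (snd z) \<bullet> fst (snd z))"
    "smooth_fun (\<lambda>z :: 'n phase. fst (snd z) \<bullet> snd (snd z))"
    "smooth_fun (\<lambda>z :: 'n phase. snd (snd z) \<bullet> fst (snd z))"
    "smooth_fun (\<lambda>z :: 'n phase. snd (snd z) \<bullet> snd (snd z))"
  by (intro smooth_inner smooth_bounded_linear bounded_linear_compose[OF bounded_linear_inner_left]
      bounded_linear_compose[OF bounded_linear_fst] bounded_linear_compose[OF bounded_linear_snd]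
      bounded_linear_fst bounded_linear_snd bounded_linear_ident)+

lemma pot_smooth: "smooth_fun profile" "smooth_fun potA" "smooth_fun (potB i)"
  unfolding profile_def[abs_def] potA_def[abs_def] potB_def[abs_def]
  by (intro smooth_diff smooth_add smooth_mult smooth_const bump_smooth smooth_coords)+

text \<open>A fixed support keeps every pairing under the indicator of one ball, the weight of
  \<open>kin_avg\<close>, and the class is stable under the derivatives used.\<close>

definition supp_ball :: "('n::finite phase \<Rightarrow> real) \<Rightarrow> bool" where
  "supp_ball \<phi> \<longleftrightarrow> smooth_fun \<phi> \<and> (\<forall>z. norm z > 1 \<longrightarrow> \<phi> z = 0)"

lemma supp_ballD:
  assumes "supp_ball \<phi>"
  shows "smooth_fun \<phi>" "norm z > 1 \<Longrightarrow> \<phi> z = 0"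
  using assms unfolding supp_ball_def by blast+

lemma supp_ball_test_fun: "supp_ball \<phi> \<Longrightarrow> test_fun \<phi>"
proof -
  assume "supp_ball \<phi>"
  moreover from this have "{z. \<phi> z \<noteq> 0} \<subseteq> cball 0 1"
    unfolding supp_ball_def by (force simp: not_less)
  ultimately show ?thesis
    unfolding test_fun_def supp_ball_def using bounded_cball bounded_subset compact_closure by blast
qed

lemma supp_ball_derivs:
  fixes \<phi> :: "'n::finite phase \<Rightarrow> real"
  assumes "supp_ball \<phi>"
  shows "supp_ball (kin_deriv \<phi>)" "supp_ball (dv \<phi> i)"
proof -
  have s: "smooth_fun \<phi>" and 0: "\<And>z. norm z > 1 \<Longrightarrow> \<phi> z = 0"
    using assms by (auto simp: supp_ball_def)
  have "frechet_derivative \<phi> (at z) = (\<lambda>h. 0)" if "norm z > 1" for z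
  proof -
    have "open {z :: 'n phase. norm z > 1}"
      by (intro open_Collect_less continuous_intros)
    then have "(\<phi> has_derivative (\<lambda>h. 0)) (at z)"
      using has_derivative_transform_within_open[of "\<lambda>_. 0" "\<lambda>h. 0" z UNIV "{z. norm z > 1}" \<phi>] that 0
      by auto
    then show ?thesis using frechet_derivative_at by metis
  qed
  then show "supp_ball (kin_deriv \<phi>)" "supp_ball (dv \<phi> i)"
    using smooth_derivs[OF s] by (auto simp: supp_ball_def kin_deriv_def dt_def transport_def dv_def)
qed

lemma pot_supp_ball: "supp_ball (bump p)" "supp_ball profile" "supp_ball potA" "supp_ball (potB i)"
  unfolding supp_ball_def
  by (simp_all add: pot_smooth bump_smooth bump_outside profile_def potA_def potB_def del: split_paired_All)

text \<open>With P = \<open>bump 1\<close>, X the kinetic derivative and G as above,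
  \<open>potA\<close> is 2 s P - div_w G and \<open>potB i\<close> is w_i P + X G_i. The
  second-order terms X div_w G and div_w X G differ by div_y G, which completes X (2 s P) + div_w (w
  P) to the divergence. The proof checks this as a polynomial identity in which the terms with
  \<open>P2\<close> cancel.\<close>

lemma profile_decomposition:
  fixes z :: "'n::finite phase"
  shows "kin_deriv potA z + (\<Sum>i\<in>UNIV. dv (potB i) i z) = profile z"
proof -
  obtain s y w where z: "z = (s, y, w)" by (cases z) auto
  note d = bump_has_derivative[of 1 z] bump_has_derivative[of "flat_step 1" z]
  define P P1 P2 where "P = bump 1 z" and "P1 = bump (flat_step 1) z" and "P2 = bump (flat_step (flat_step 1)) z"
  \<comment> \<open>Half the kinetic derivative of |z|^2, so that \<open>bump p\<close> has kinetic
    derivative - 2 m \<open>bump (flat_step p)\<close>.\<close>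
  define m where "m = s + w \<bullet> y"
  have A: "(potA has_derivative (\<lambda>h. (2 + 2 * real CARD('n)) * (fst h * P + s * (P1 * (- 2 * (z \<bullet> h))))
       + 2 * ((P2 * (- 2 * (z \<bullet> h))) * (3 * (y \<bullet> w) - 2 * (s * (w \<bullet> w)))
          + P1 * (3 * (fst (snd h) \<bullet> w + y \<bullet> snd (snd h)) - 2 * (fst h * (w \<bullet> w) + s * (2 * (w \<bullet> snd (snd h)))))))) (at z)"
    unfolding potA_def[abs_def] P_def P1_def P2_def
    by (rule derivative_eq_intros d refl)+ (auto simp: z fun_eq_iff inner_commute algebra_simps)
  have B: "(potB i has_derivative (\<lambda>h. 2 * ((snd (snd h) \<bullet> axis i 1) * P + (w \<bullet> axis i 1) * (P1 * (- 2 * (z \<bullet> h))))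
       - 2 * (((3 * (fst (snd h) \<bullet> axis i 1) - 2 * (fst h * (w \<bullet> axis i 1) + s * (snd (snd h) \<bullet> axis i 1))) * P1
          + (3 * (y \<bullet> axis i 1) - 2 * (s * (w \<bullet> axis i 1))) * (P2 * (- 2 * (z \<bullet> h)))) * m
          + (3 * (y \<bullet> axis i 1) - 2 * (s * (w \<bullet> axis i 1))) * P1 * (fst h + snd (snd h) \<bullet> y + w \<bullet> fst (snd h))))) (at z)" for i
    unfolding potB_def[abs_def] P_def P1_def P2_def m_def
    by (rule derivative_eq_intros d refl)+ (auto simp: z fun_eq_iff inner_commute algebra_simps)
  have "kin_deriv potA z = (2 + 2 * real CARD('n)) * (P + s * (P1 * (- 2 * m)))
       + 2 * ((P2 * (- 2 * m)) * (3 * (y \<bullet> w) - 2 * (s * (w \<bullet> w))) + P1 * (w \<bullet> w))"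
  proof -
    from kin_deriv_eq[OF pot_smooth(2), of z] show ?thesis
      unfolding frechet_derivative_at[OF A, symmetric] by (simp add: z m_def inner_commute algebra_simps)
  qed
  moreover have dv: "dv (potB i) i z = (2 * P + 4 * s * m * P1) + (- 4 * P1 - 8 * m * P2 * s) * (w $ i * w $ i)
      + (12 * m * P2 + 4 * P1 * s) * (y $ i * w $ i) + (- 6 * P1) * (y $ i * y $ i)" for i
    unfolding dv_def frechet_derivative_at[OF B, symmetric]
    by (simp add: z inner_axis inner_axis' algebra_simps)
  have "(\<Sum>i\<in>UNIV. dv (potB i) i z) = real CARD('n) * (2 * P + 4 * s * m * P1) + (- 4 * P1 - 8 * m * P2 * s) * (w \<bullet> w)
      + (12 * m * P2 + 4 * P1 * s) * (y \<bullet> w) + (- 6 * P1) * (y \<bullet> y)"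
    unfolding inner_vec_def dv inner_real_def
    by (simp only: sum.distrib sum_distrib_left[symmetric] sum_constant) (simp add: algebra_simps)
  ultimately show ?thesis
    unfolding profile_def P_def[symmetric] P1_def[symmetric]
    by (simp add: z m_def inner_commute algebra_simps)
qed

section \<open>Bounds and integrability for pairings with functions supported in the unit
  ball\<close>

lemma continuous_ball_bounded:
  fixes \<phi> :: "'n::finite phase \<Rightarrow> 'b::real_normed_vector"
  assumes "continuous_on UNIV \<phi>" "\<And>z. norm z > 1 \<Longrightarrow> \<phi> z = 0"
  obtains C where "C \<ge> 0" "\<And>z. norm (\<phi> z) \<le> C * indicator (cball 0 1) z"
proof -
  have "compact (\<phi> ` cball 0 1)"
    by (intro compact_continuous_image continuous_on_subset[OF assms(1)]) auto
  then obtain C where C: "\<And>z. z \<in> cball 0 1 \<Longrightarrow> norm (\<phi> z) \<le> C"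
    by (meson bounded_iff compact_imp_bounded image_eqI)
  show ?thesis
  proof (rule that[of C])
    show "C \<ge> 0" using C[of 0] norm_ge_zero[of "\<phi> 0"] by (simp del: norm_ge_zero)
    show "norm (\<phi> z) \<le> C * indicator (cball 0 1) z" for z
      using C[of z] assms(2)[of z] by (auto simp: indicator_def not_le)
  qed
qed

lemma integrable_mult_L2:
  assumes [measurable]: "f \<in> borel_measurable M" "\<phi> \<in> borel_measurable M"
    and "integrable M (\<lambda>z. (f z)\<^sup>2)" "integrable M (\<lambda>z. (\<phi> z)\<^sup>2)"
  shows "integrable M (\<lambda>z. f z * \<phi> z :: real)"
proof (rule Bochner_Integration.integrable_bound)
  show "integrable M (\<lambda>z. ((f z)\<^sup>2 + (\<phi> z)\<^sup>2) / 2)"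
    using assms by auto
  have "\<bar>a * b\<bar> \<le> (a\<^sup>2 + b\<^sup>2) / 2" for a b :: real
    using sum_squares_bound[of "\<bar>a\<bar>" "\<bar>b\<bar>"] by (simp add: abs_mult)
  then show "AE z in M. norm (f z * \<phi> z) \<le> norm (((f z)\<^sup>2 + (\<phi> z)\<^sup>2) / 2)"
    by (intro AE_I2) (smt (verit, best) real_norm_def)
qed measurable

lemma supp_ball_square_integrable:
  assumes "supp_ball \<phi>"
  shows "integrable lborel (\<lambda>z. (\<phi> z)\<^sup>2)"
proof -
  obtain C where C: "\<And>z. norm (\<phi> z) \<le> C * indicator (cball 0 1) z"
    using continuous_ball_bounded[of \<phi>, OF smooth_continuous[OF supp_ballD(1)[OF assms]] supp_ballD(2)[OF assms]] by blast
  have [measurable]: "\<phi> \<in> borel_measurable borel"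
    by (rule smooth_measurable[OF supp_ballD(1)[OF assms]])
  show ?thesis
  proof (rule Bochner_Integration.integrable_bound)
    show "integrable lborel (\<lambda>z. C\<^sup>2 * indicat_real (cball 0 1) z)"
      by (intro integrable_mult_right integrable_real_indicator emeasure_bounded_finite) auto
    have "(\<phi> z)\<^sup>2 \<le> C\<^sup>2 * indicat_real (cball 0 1) z" for z
      using power_mono[OF C[of z], of 2] by (cases "norm z \<le> 1") (auto simp: power_mult_distrib)
    then show "AE z in lborel. norm ((\<phi> z)\<^sup>2) \<le> norm (C\<^sup>2 * indicat_real (cball 0 1) z)"
      by (intro AE_I2) (simp add: abs_mult)
  qed measurable
qed

lemma L2_mult_integrable:
  fixes f :: "'n::finite phase \<Rightarrow> real"
  assumes "L2 f" "supp_ball \<phi>" and r: "r > 0"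
  shows "integrable lborel (\<lambda>w. f (mv z r w) * \<phi> w)"
proof (rule integrable_mult_L2)
  have [measurable]: "f \<in> borel_measurable borel" using assms by (simp add: L2_def)
  show "integrable lborel (\<lambda>w. (f (mv z r w))\<^sup>2)"
    by (subst integrable_mv[OF _ r]) (use assms in \<open>auto simp: L2_def\<close>)
  show "(\<lambda>w. f (mv z r w)) \<in> borel_measurable lborel" by measurable
  show "\<phi> \<in> borel_measurable lborel"
    using smooth_measurable[OF supp_ballD(1)[OF assms(2)]] by simp
  show "integrable lborel (\<lambda>w. (\<phi> w)\<^sup>2)"
    by (rule supp_ball_square_integrable[OF assms(2)])
qed

lemma L2v_component: "L2v g \<Longrightarrow> L2 (\<lambda>z. g z $ i)"
proof -
  assume g: "L2v g"
  then have [measurable]: "g \<in> borel_measurable borel" by (simp add: L2v_def)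
  have [measurable]: "(\<lambda>z. g z $ i) \<in> borel_measurable borel"
    by (rule measurable_compose[of g _ borel]) (auto intro!: borel_measurable_continuous_onI continuous_intros)
  have "integrable lborel (\<lambda>z. (g z $ i)\<^sup>2)"
  proof (rule Bochner_Integration.integrable_bound)
    show "integrable lborel (\<lambda>z. (norm (g z))\<^sup>2)" using g by (simp add: L2v_def)
    show "AE z in lborel. norm ((g z $ i)\<^sup>2) \<le> norm ((norm (g z))\<^sup>2)"
      using component_le_norm_cart power_mono by (intro AE_I2) (fastforce simp: power2_le_iff_abs_le)
  qed measurable
  then show ?thesis by (simp add: L2_def)
qed

text \<open>The average of \<open>h\<close> over the kinetic ball of radius \<open>r\<close> around \<open>z\<close>, up to a constant factor.\<close>

definition kin_avg :: "('n::finite phase \<Rightarrow> ennreal) \<Rightarrow> 'n phase \<Rightarrow> real \<Rightarrow> ennreal" where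
  "kin_avg h z r = (\<integral>\<^sup>+w. h (mv z r w) * indicator (cball 0 1) w \<partial>lborel)"

text \<open>Insert the decomposition of \<open>profile\<close>: the kinetic equation trades the
  kinetic derivative of \<open>potA\<close> for \<open>grad_v potA\<close> against \<open>S\<close>,
  the weak gradient trades the divergence for \<open>potB\<close> against \<open>g\<close>, each
  with a factor \<open>r\<close>. The constant is a sum of two suprema, hence independent of
  \<open>f\<close>, \<open>z\<close> and \<open>r\<close>.\<close>

lemma integral_profile_bound:
  "\<exists>C\<ge>0. \<forall>(f :: 'n::finite phase \<Rightarrow> real) g S z r.
    L2 f \<and> L2v g \<and> weak_grad_v f g \<and> L2v S \<and> kinetic_eq f S \<and> r > 0 \<longrightarrow>
    ennreal \<bar>LINT w|lborel. f (mv z r w) * profile w\<bar>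
      \<le> ennreal (r * C) * kin_avg (\<lambda>u. ennreal (norm (g u) + norm (S u))) z r"
proof -
  let ?B = "\<lambda>w :: 'n phase. (\<chi> i. potB i w)"
  have "continuous_on UNIV (grad_v (potA :: 'n phase \<Rightarrow> real))"
    unfolding grad_v_def[abs_def]
    by (intro continuous_on_vec_lambda smooth_continuous smooth_derivs pot_smooth)
  moreover have "grad_v potA w = 0" if "norm w > 1" for w :: "'n phase"
    using supp_ballD(2)[OF supp_ball_derivs(2)[OF pot_supp_ball(3)] that] by (simp add: grad_v_def vec_eq_iff)
  ultimately obtain CA where CA: "CA \<ge> 0" "\<And>w :: 'n phase. norm (grad_v potA w) \<le> CA * indicator (cball 0 1) w"
    using continuous_ball_bounded by blast
  have "continuous_on UNIV ?B"
    by (intro continuous_on_vec_lambda smooth_continuous pot_smooth)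
  moreover have "?B w = 0" if "norm w > 1" for w :: "'n phase"
    using supp_ballD(2)[OF pot_supp_ball(4) that] by (simp add: vec_eq_iff)
  ultimately obtain CB where CB: "CB \<ge> 0" "\<And>w :: 'n phase. norm (?B w) \<le> CB * indicator (cball 0 1) w"
    using continuous_ball_bounded by blast
  show ?thesis
  proof (intro exI[of _ "CA + CB"] conjI allI impI; (elim conjE)?)
    show "0 \<le> CA + CB" using CA CB by simp
    fix f :: "'n phase \<Rightarrow> real" and g S z and r :: real
    assume f: "L2 f" and g: "L2v g" and fg: "weak_grad_v f g" and S: "L2v S" and fS: "kinetic_eq f S" and r: "0 < r"
    have [measurable]: "f \<in> borel_measurable borel" "g \<in> borel_measurable borel" "S \<in> borel_measurable borel"
      using f g S by (auto simp: L2_def L2v_def)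
    note [measurable] = grad_v_measurable[OF pot_smooth(2)]
    have [measurable]: "cball (0 :: 'n phase) 1 \<in> sets borel" by simp
    have [measurable]: "?B \<in> borel_measurable borel"
      by (rule borel_measurable_continuous_onI) fact
    let ?I = "\<lambda>w. S (mv z r w) \<bullet> grad_v potA w - g (mv z r w) \<bullet> ?B w"
    have iA: "integrable lborel (\<lambda>w. S (mv z r w) \<bullet> grad_v potA w)"
      unfolding inner_vec_def grad_v_def
      by (auto intro!: Bochner_Integration.integrable_sum L2_mult_integrable[OF L2v_component[OF S] _ r] supp_ball_derivs pot_supp_ball)
    have iB': "integrable lborel (\<lambda>w. g (mv z r w) $ i * potB i w)" for i
      by (intro L2_mult_integrable[OF L2v_component[OF g] _ r] pot_supp_ball)
    have iB: "integrable lborel (\<lambda>w. g (mv z r w) \<bullet> ?B w)"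
      unfolding inner_vec_def by (auto intro!: Bochner_Integration.integrable_sum iB')
    have "(LINT w|lborel. f (mv z r w) * profile w) =
       (LINT w|lborel. f (mv z r w) * kin_deriv potA w + (\<Sum>i\<in>UNIV. f (mv z r w) * dv (potB i) i w))"
      unfolding profile_decomposition[symmetric] by (simp add: distrib_left sum_distrib_left)
    also have "\<dots> = (LINT w|lborel. f (mv z r w) * kin_deriv potA w) + (\<Sum>i\<in>UNIV. LINT w|lborel. f (mv z r w) * dv (potB i) i w)"
      by (subst Bochner_Integration.integral_add, intro L2_mult_integrable[OF f _ r] supp_ball_derivs pot_supp_ball,
          intro Bochner_Integration.integrable_sum L2_mult_integrable[OF f _ r] supp_ball_derivs pot_supp_ball,
          subst Bochner_Integration.integral_sum, intro L2_mult_integrable[OF f _ r] supp_ball_derivs pot_supp_ball, rule refl)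
    also have "\<dots> = r * (LINT w|lborel. S (mv z r w) \<bullet> grad_v potA w) + (\<Sum>i\<in>UNIV. - r * (LINT w|lborel. g (mv z r w) $ i * potB i w))"
      using kinetic_eq_mv[OF _ _ fS supp_ball_test_fun[OF pot_supp_ball(3)] r, of z]
        weak_grad_v_mv[OF _ _ fg supp_ball_test_fun[OF pot_supp_ball(4)] r, of z] by simp
    also have "\<dots> = r * (LINT w|lborel. ?I w)"
      using iA iB iB' by (subst Bochner_Integration.integral_diff)
        (auto simp: inner_vec_def Bochner_Integration.integral_sum sum_distrib_left sum_negf algebra_simps)
    finally have eq: "(LINT w|lborel. f (mv z r w) * profile w) = r * (LINT w|lborel. ?I w)" .
    have pt: "\<bar>?I w\<bar> \<le> (CA + CB) * ((norm (g (mv z r w)) + norm (S (mv z r w))) * indicator (cball 0 1) w)" for w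
    proof -
      have "\<bar>?I w\<bar> \<le> norm (S (mv z r w)) * norm (grad_v potA w) + norm (g (mv z r w)) * norm (?B w)"
        using Cauchy_Schwarz_ineq2[of "S (mv z r w)" "grad_v potA w"] Cauchy_Schwarz_ineq2[of "g (mv z r w)" "?B w"] by linarith
      also have "\<dots> \<le> norm (S (mv z r w)) * (CA * indicator (cball 0 1) w) + norm (g (mv z r w)) * (CB * indicator (cball 0 1) w)"
        by (intro add_mono mult_left_mono CA CB) auto
      also have "\<dots> \<le> (CA + CB) * ((norm (g (mv z r w)) + norm (S (mv z r w))) * indicator (cball 0 1) w)"
        using CA(1) CB(1) by (auto simp: indicator_def algebra_simps)
      finally show ?thesis .
    qed
    have "ennreal \<bar>LINT w|lborel. ?I w\<bar> \<le> (\<integral>\<^sup>+w. ennreal (norm (?I w)) \<partial>lborel)"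
      using integral_norm_bound_ennreal[OF Bochner_Integration.integrable_diff[OF iA iB]] by simp
    also have "\<dots> \<le> (\<integral>\<^sup>+w. ennreal (CA + CB) * (ennreal (norm (g (mv z r w)) + norm (S (mv z r w))) * indicator (cball 0 1) w) \<partial>lborel)"
      using pt CA CB by (intro nn_integral_mono)
        (simp add: ennreal_indicator[symmetric] ennreal_mult[symmetric] ennreal_leI del: ennreal_plus)
    also have "\<dots> = ennreal (CA + CB) * kin_avg (\<lambda>u. ennreal (norm (g u) + norm (S u))) z r"
      unfolding kin_avg_def by (rule nn_integral_cmult) measurable
    finally have "ennreal r * ennreal \<bar>LINT w|lborel. ?I w\<bar> \<le> ennreal r * (ennreal (CA + CB) * kin_avg (\<lambda>u. ennreal (norm (g u) + norm (S u))) z r)"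
      by (rule mult_left_mono) simp
    then show "ennreal \<bar>LINT w|lborel. f (mv z r w) * profile w\<bar>
      \<le> ennreal (r * (CA + CB)) * kin_avg (\<lambda>u. ennreal (norm (g u) + norm (S u))) z r"
      unfolding eq using r CA CB by (simp add: abs_mult ennreal_mult mult.assoc del: ennreal_plus)
  qed
qed

section \<open>Kinetic mollification\<close>

text \<open>Not normalised: for continuous \<open>f\<close> the limit as r tends to 0 is
  \<open>f\<close> times the mass of the bump.\<close>

definition kin_mol :: "('n::finite phase \<Rightarrow> real) \<Rightarrow> 'n phase \<Rightarrow> real \<Rightarrow> real" where
  "kin_mol f z r = (LINT w|lborel. f (mv z r w) * bump 1 w)"

text \<open>The weight is dr and not dr / r, because the factor \<open>r\<close> in
  \<open>integral_profile_bound\<close> cancels the 1/r that differentiation in the scale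
  produces.\<close>

definition kin_pot :: "('n::finite phase \<Rightarrow> ennreal) \<Rightarrow> 'n phase \<Rightarrow> ennreal" where
  "kin_pot h z = (\<integral>\<^sup>+r. kin_avg h z r * indicator {0<..} r \<partial>lborel)"

lemma cball_sets [measurable]: "cball a r \<in> sets (borel :: 'a::metric_space measure)"
  by simp

lemma profile_measurable [measurable]: "profile \<in> borel_measurable borel"
  and bump_measurable [measurable]: "bump p \<in> borel_measurable borel"
  by (intro smooth_measurable pot_smooth bump_smooth)+

text \<open>In the variable \<open>u\<close> the scale sits in the kernel alone. With P =
  \<open>bump 1\<close>, the r-derivative is -1 / r^(Q + 1) times Q P plus the dilation generator
  applied to P, and Q is the divergence of the generator, so this sum is
  \<open>profile\<close>.\<close>

lemma scaled_bump_deriv: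
  fixes z u :: "'n::finite phase"
  assumes r: "r > 0"
  shows "((\<lambda>r. (1 / r ^ hdim TYPE('n)) * bump 1 (mv_inv z r u)) has_real_derivative
     - (1 / r ^ Suc (hdim TYPE('n))) * profile (mv_inv z r u)) (at r)"
proof -
  define a b c where "a = fst u - fst z" and "b = fst (snd u) - fst (snd z) - a *\<^sub>R snd (snd z)"
    and "c = snd (snd u) - snd (snd z)"
  define A B C where "A = a * a" and "B = b \<bullet> b" and "C = c \<bullet> c"
  have N: "mv_inv z r u = ((1/r^2) * a, (1/r^3) *\<^sub>R b, (1/r) *\<^sub>R c)" for r
    by (simp add: mv_inv_def a_def b_def c_def)
  \<comment> \<open>The powers 4, 6, 2 come from squaring the dilation weights r^2, r^3, r.\<close>
  define q where "q r = 1 - (A * (1 / r ^ 4) + B * (1 / r ^ 6) + C * (1 / r ^ 2))" for r :: real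
  have bump: "bump p (mv_inv z r u) = flat p (q r)" for p r
    unfolding bump_def N q_def A_def B_def C_def
    by (simp add: power_mult_distrib power2_eq_square power3_eq_cube numeral_eq_Suc mult.assoc add.assoc)
  define E where "E = 2 * A * (1 / r ^ 4) + 3 * B * (1 / r ^ 6) + C * (1 / r ^ 2)"
  have prof: "profile (mv_inv z r u) = hdim TYPE('n) * flat 1 (q r) - 2 * flat (flat_step 1) (q r) * E"
    unfolding profile_def bump unfolding N E_def A_def B_def C_def
    by (simp add: power_mult_distrib power2_eq_square power3_eq_cube numeral_eq_Suc mult.assoc)
  have pow: "((\<lambda>r. 1 / r ^ k) has_real_derivative - real k * (1 / r ^ k) * (1 / r)) (at r)" for k
  proof (induction k)
    case (Suc k)
    have "((\<lambda>r. 1 / r) has_real_derivative - (1 / r) * (1 / r)) (at r)"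
      using r by (auto intro!: derivative_eq_intros simp: field_simps)
    from DERIV_mult[OF this Suc] show ?case by (simp add: algebra_simps diff_divide_distrib)
  qed simp
  have q': "(q has_real_derivative 2 * E * (1 / r)) (at r)"
    unfolding q_def[abs_def] E_def
    by (rule derivative_eq_intros pow refl)+ (simp add: algebra_simps)
  have "((\<lambda>r. (1 / r ^ hdim TYPE('n)) * flat 1 (q r)) has_real_derivative
     - real (hdim TYPE('n)) * (1 / r ^ hdim TYPE('n)) * (1 / r) * flat 1 (q r) + flat (flat_step 1) (q r) * (2 * E * (1 / r)) * (1 / r ^ hdim TYPE('n))) (at r)"
    by (rule DERIV_mult[OF pow DERIV_chain2[OF flat_deriv q']])
  moreover have "- real (hdim TYPE('n)) * (1 / r ^ hdim TYPE('n)) * (1 / r) * flat 1 (q r) + flat (flat_step 1) (q r) * (2 * E * (1 / r)) * (1 / r ^ hdim TYPE('n))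
     = - (1 / r ^ Suc (hdim TYPE('n))) * profile (mv_inv z r u)"
    unfolding prof power_Suc using r by (simp add: field_simps)
  ultimately show ?thesis
    unfolding bump by simp
qed

lemma mv_inv_continuous_on_r: "continuous_on {a..b} (\<lambda>r. mv_inv z r u)" if "a > 0"
  unfolding mv_inv_def using that by (auto intro!: continuous_intros)

lemma integral_mv_inv:
  fixes f :: "'n::finite phase \<Rightarrow> real"
  assumes [measurable]: "f \<in> borel_measurable borel" "\<phi> \<in> borel_measurable borel" and r: "r > 0"
  shows "(LINT w|lborel. f (mv z r w) * \<phi> w) = (1 / r ^ hdim TYPE('n)) * (LINT u|lborel. f u * \<phi> (mv_inv z r u))"
  using integral_mv[of "\<lambda>u. f u * \<phi> (mv_inv z r u)" r z] r by (simp add: mv_inv_mv)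

lemma integrable_mv_inv:
  fixes f :: "'n::finite phase \<Rightarrow> real"
  assumes [measurable]: "f \<in> borel_measurable borel" "\<phi> \<in> borel_measurable borel" and r: "r > 0"
  shows "integrable lborel (\<lambda>w. f (mv z r w) * \<phi> w) \<longleftrightarrow> integrable lborel (\<lambda>u. f u * \<phi> (mv_inv z r u))"
  using integrable_mv[of "\<lambda>u. f u * \<phi> (mv_inv z r u)" r z] r by (simp add: mv_inv_mv)

lemma nn_integral_mv_inv:
  fixes F :: "'n::finite phase \<Rightarrow> ennreal"
  assumes [measurable]: "F \<in> borel_measurable borel" and r: "r > 0"
  shows "(\<integral>\<^sup>+u. F (mv_inv z r u) \<partial>lborel) = ennreal (r ^ hdim TYPE('n)) * (\<integral>\<^sup>+w. F w \<partial>lborel)"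
  using nn_integral_mv_right[of "\<lambda>u. F (mv_inv z r u)" r z] r
  by (simp add: mv_inv_mv mult.assoc[symmetric] ennreal_mult[symmetric] del: power_Suc power_add)

text \<open>Justifies exchanging the integrals over scale and phase space. The scales stay in a
  compact interval away from 0, and |f profile| is dominated by f^2 + profile^2, both
  integrable.\<close>

lemma scaled_profile_integrable:
  fixes f :: "'n::finite phase \<Rightarrow> real"
  assumes f: "L2 f" and ab: "0 < a" "a \<le> b"
  shows "integrable (lborel \<Otimes>\<^sub>M lborel) (\<lambda>(r, u). indicator {a..b} r * (- (1 / r ^ Suc (hdim TYPE('n)))) * (f u * profile (mv_inv z r u)))"
proof (rule integrableI_bounded)
  have [measurable]: "f \<in> borel_measurable borel" using f by (simp add: L2_def)
  let ?Q = "hdim TYPE('n)"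
  let ?H = "\<lambda>(r, u). indicator {a..b} r * (- (1 / r ^ Suc ?Q)) * (f u * profile (mv_inv z r u)) :: real"
  show m: "?H \<in> borel_measurable (lborel \<Otimes>\<^sub>M lborel)"
    by measurable
  define E E' where "E = (\<integral>\<^sup>+u. ennreal ((f u)\<^sup>2) \<partial>lborel)" and "E' = (\<integral>\<^sup>+u. ennreal ((profile (u :: 'n phase))\<^sup>2) \<partial>lborel)"
  have E: "E < \<infinity>" "E' < \<infinity>"
    using f supp_ball_square_integrable[OF pot_supp_ball(2)]
    by (auto simp: E_def E'_def L2_def integrable_iff_bounded)
  let ?M = "ennreal (1 / a ^ Suc ?Q) * (E + ennreal (b ^ ?Q) * E')"
  have "(\<integral>\<^sup>+x. ennreal (norm (?H x)) \<partial>(lborel \<Otimes>\<^sub>M lborel)) = (\<integral>\<^sup>+r. \<integral>\<^sup>+u. ennreal (norm (?H (r, u))) \<partial>lborel \<partial>lborel)"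
    by (rule lborel.nn_integral_fst[symmetric]) measurable
  also have "\<dots> \<le> (\<integral>\<^sup>+r. ?M * indicator {a..b} r \<partial>lborel)"
  proof (rule nn_integral_mono)
    fix r :: real
    show "(\<integral>\<^sup>+u. ennreal (norm (?H (r, u))) \<partial>lborel) \<le> ?M * indicator {a..b} r"
    proof (cases "r \<in> {a..b}")
      case True
      then have r: "r > 0" using ab by auto
      have *: "\<bar>x * y\<bar> \<le> x\<^sup>2 + y\<^sup>2" for x y :: real
        using sum_squares_bound[of "\<bar>x\<bar>" "\<bar>y\<bar>"] mult_nonneg_nonneg[of "\<bar>x\<bar>" "\<bar>y\<bar>"]
        unfolding abs_mult power2_abs by linarith
      have "(\<integral>\<^sup>+u. ennreal (norm (?H (r, u))) \<partial>lborel)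
          \<le> (\<integral>\<^sup>+u. ennreal (1 / a ^ Suc ?Q) * (ennreal ((f u)\<^sup>2) + ennreal ((profile (mv_inv z r u))\<^sup>2)) \<partial>lborel)"
      proof (rule nn_integral_mono)
        fix u
        have "norm (?H (r, u)) = (1 / r ^ Suc ?Q) * \<bar>f u * profile (mv_inv z r u)\<bar>"
          using True r by (simp add: abs_mult)
        also have "\<dots> \<le> (1 / a ^ Suc ?Q) * ((f u)\<^sup>2 + (profile (mv_inv z r u))\<^sup>2)"
          using True ab r by (intro mult_mono divide_left_mono power_mono * mult_pos_pos zero_less_power) auto
        finally show "ennreal (norm (?H (r, u))) \<le> ennreal (1 / a ^ Suc ?Q) * (ennreal ((f u)\<^sup>2) + ennreal ((profile (mv_inv z r u))\<^sup>2))"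
          using ab by (simp add: ennreal_plus[symmetric] ennreal_mult[symmetric] ennreal_leI del: ennreal_plus power_Suc)
      qed
      also have "\<dots> = ennreal (1 / a ^ Suc ?Q) * (E + (\<integral>\<^sup>+u. ennreal ((profile (mv_inv z r u))\<^sup>2) \<partial>lborel))"
        unfolding E_def by (subst nn_integral_cmult, measurable, subst nn_integral_add, measurable)
      also have "\<dots> = ennreal (1 / a ^ Suc ?Q) * (E + ennreal (r ^ ?Q) * E')"
        unfolding E'_def by (subst nn_integral_mv_inv[OF _ r]) auto
      also have "\<dots> \<le> ?M"
        using True r by (intro mult_left_mono add_left_mono mult_right_mono ennreal_leI power_mono) auto
      finally show ?thesis using True by simp
    qed simp
  qed
  also have "\<dots> = ?M * ennreal (b - a)"
    using ab by (subst nn_integral_cmult) auto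
  also have "\<dots> < \<infinity>"
    using E by (simp add: ennreal_mult_less_top)
  finally show "(\<integral>\<^sup>+x. ennreal (norm (?H x)) \<partial>(lborel \<Otimes>\<^sub>M lborel)) < \<infinity>" .
qed

text \<open>The fundamental theorem of calculus is applied to the smooth kernel for each fixed
  \<open>u\<close>, then integrated against \<open>f\<close>; the change of variables back to
  \<open>w\<close> turns 1 / r^(Q + 1) into 1 / r.\<close>

lemma kin_mol_diff:
  fixes f :: "'n::finite phase \<Rightarrow> real"
  assumes f: "L2 f" and ab: "0 < a" "a \<le> b"
  shows "kin_mol f z b - kin_mol f z a =
     (LINT r|lborel. indicator {a..b} r * (- (1 / r)) * (LINT w|lborel. f (mv z r w) * profile w))"
proof -
  have [measurable]: "f \<in> borel_measurable borel" using f by (simp add: L2_def)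
  let ?Q = "hdim TYPE('n)"
  let ?H = "\<lambda>r u. indicator {a..b} r * (- (1 / r ^ Suc ?Q)) * (f u * profile (mv_inv z r u)) :: real"
  have mol: "kin_mol f z r = (LINT u|lborel. f u * ((1 / r ^ ?Q) * bump 1 (mv_inv z r u)))"
    and int: "integrable lborel (\<lambda>u. f u * ((1 / r ^ ?Q) * bump 1 (mv_inv z r u)))" if r: "r > 0" for r
  proof -
    have "integrable lborel (\<lambda>u. f u * bump 1 (mv_inv z r u))"
      using L2_mult_integrable[OF f pot_supp_ball(1) r] by (simp add: integrable_mv_inv[OF _ _ r])
    then have "integrable lborel (\<lambda>u. (1 / r ^ ?Q) * (f u * bump 1 (mv_inv z r u)))"
      by (rule integrable_mult_right)
    then show "integrable lborel (\<lambda>u. f u * ((1 / r ^ ?Q) * bump 1 (mv_inv z r u)))"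
      by (simp only: ac_simps)
    show "kin_mol f z r = (LINT u|lborel. f u * ((1 / r ^ ?Q) * bump 1 (mv_inv z r u)))"
      unfolding kin_mol_def
      using integral_mv_inv[OF _ bump_measurable r, of f z 1]
      by (simp only: integral_mult_right_zero[symmetric]) (simp add: ac_simps)
  qed
  have "kin_mol f z b - kin_mol f z a =
    (LINT u|lborel. f u * ((1 / b ^ ?Q) * bump 1 (mv_inv z b u) - (1 / a ^ ?Q) * bump 1 (mv_inv z a u)))"
    using ab int[of a] int[of b] by (simp add: mol Bochner_Integration.integral_diff[symmetric] right_diff_distrib)
  also have "\<dots> = (LINT u|lborel. LINT r|lborel. ?H r u)"
  proof (rule Bochner_Integration.integral_cong[OF refl])
    fix u :: "'n phase"
    have "(LINT r|lborel. indicator {a..b} r *\<^sub>R (- (1 / r ^ Suc ?Q) * profile (mv_inv z r u))) =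
       (1 / b ^ ?Q) * bump 1 (mv_inv z b u) - (1 / a ^ ?Q) * bump 1 (mv_inv z a u)"
    proof (rule integral_FTC_atLeastAtMost[OF ab(2)])
      fix x assume "a \<le> x" "x \<le> b"
      then have "x > 0" using ab by simp
      from scaled_bump_deriv[OF this]
      show "((\<lambda>r. (1 / r ^ ?Q) * bump 1 (mv_inv z r u)) has_vector_derivative - (1 / x ^ Suc ?Q) * profile (mv_inv z x u)) (at x within {a..b})"
        unfolding has_real_derivative_iff_has_vector_derivative by (rule has_vector_derivative_at_within)
    next
      show "continuous_on {a..b} (\<lambda>r. - (1 / r ^ Suc ?Q) * profile (mv_inv z r u))"
        using ab by (intro continuous_intros continuous_on_compose2[OF smooth_continuous[OF pot_smooth(1)] mv_inv_continuous_on_r]) auto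
    qed
    then have "f u * ((1 / b ^ ?Q) * bump 1 (mv_inv z b u) - (1 / a ^ ?Q) * bump 1 (mv_inv z a u)) =
       f u * (LINT r|lborel. indicator {a..b} r *\<^sub>R (- (1 / r ^ Suc ?Q) * profile (mv_inv z r u)))"
      by (simp only:)
    also have "\<dots> = (LINT r|lborel. f u * (indicator {a..b} r *\<^sub>R (- (1 / r ^ Suc ?Q) * profile (mv_inv z r u))))"
      by (rule integral_mult_right_zero[symmetric])
    also have "\<dots> = (LINT r|lborel. ?H r u)"
      unfolding real_scaleR_def by (simp only: mult_ac)
    finally show "f u * ((1 / b ^ ?Q) * bump 1 (mv_inv z b u) - (1 / a ^ ?Q) * bump 1 (mv_inv z a u)) = (LINT r|lborel. ?H r u)" .
  qed
  also have "\<dots> = (LINT r|lborel. LINT u|lborel. ?H r u)"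
    by (rule lborel_pair.Fubini_integral[OF scaled_profile_integrable[OF f ab]])
  also have "\<dots> = (LINT r|lborel. indicator {a..b} r * (- (1 / r)) * (LINT w|lborel. f (mv z r w) * profile w))"
  proof (rule Bochner_Integration.integral_cong[OF refl])
    fix r :: real
    show "(LINT u|lborel. ?H r u) = indicator {a..b} r * (- (1 / r)) * (LINT w|lborel. f (mv z r w) * profile w)"
    proof (cases "r \<in> {a..b}")
      case True
      then have r: "r > 0" using ab by auto
      show ?thesis
        unfolding integral_mult_right_zero
        using True by (subst integral_mv_inv[OF _ _ r]; simp add: mult.assoc)
    qed simp
  qed
  finally show ?thesis .
qed

text \<open>A weighted Young inequality: the term with f^2 gains r^-Q from the change of variables,
  and Q >= 2 lets this absorb the weight \<open>r\<close>, while the bump term carries 1/r.\<close>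

lemma kin_mol_decay:
  fixes f :: "'n::finite phase \<Rightarrow> real"
  assumes f: "L2 f"
  shows "(kin_mol f z \<longlongrightarrow> 0) at_top"
proof -
  have [measurable]: "f \<in> borel_measurable borel" using f by (simp add: L2_def)
  let ?Q = "hdim TYPE('n)"
  define E where "E = (LINT z|lborel. (f z)\<^sup>2) + (LINT w|lborel. (bump 1 (w :: 'n phase))\<^sup>2)"
  have "\<bar>kin_mol f z r\<bar> \<le> E * (1 / r)" if r: "r \<ge> 1" for r
  proof -
    have r0: "r > 0" using r by simp
    have i1: "integrable lborel (\<lambda>w. (f (mv z r w))\<^sup>2)"
      by (subst integrable_mv[OF _ r0]) (use f in \<open>auto simp: L2_def\<close>)
    have i2: "integrable lborel (\<lambda>w. (bump 1 (w :: 'n phase))\<^sup>2)"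
      by (rule supp_ball_square_integrable[OF pot_supp_ball(1)])
    have *: "\<bar>x * y\<bar> \<le> r * x\<^sup>2 + (1 / r) * y\<^sup>2" for x y :: real
    proof -
      have "0 \<le> (r * \<bar>x\<bar> - \<bar>y\<bar>)\<^sup>2" by simp
      then have "2 * r * (\<bar>x\<bar> * \<bar>y\<bar>) \<le> r\<^sup>2 * x\<^sup>2 + y\<^sup>2"
        by (simp add: power2_diff power_mult_distrib)
      then have "2 * (\<bar>x\<bar> * \<bar>y\<bar>) \<le> r * x\<^sup>2 + (1 / r) * y\<^sup>2"
        using r0 by (simp add: field_simps power2_eq_square)
      moreover have "0 \<le> \<bar>x\<bar> * \<bar>y\<bar>" by simp
      ultimately show ?thesis unfolding abs_mult by linarith
    qed
    have "\<bar>kin_mol f z r\<bar> \<le> (LINT w|lborel. \<bar>f (mv z r w) * bump 1 w\<bar>)"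
      unfolding kin_mol_def using integral_norm_bound[of lborel "\<lambda>w. f (mv z r w) * bump 1 w"] by simp
    also have "\<dots> \<le> (LINT w|lborel. r * (f (mv z r w))\<^sup>2 + (1 / r) * (bump 1 w)\<^sup>2)"
      by (intro integral_mono integrable_abs L2_mult_integrable[OF f pot_supp_ball(1) r0] * Bochner_Integration.integrable_add integrable_mult_right i1 i2)
    also have "\<dots> = r * (LINT w|lborel. (f (mv z r w))\<^sup>2) + (1 / r) * (LINT w|lborel. (bump 1 (w :: 'n phase))\<^sup>2)"
      using i1 i2 by (subst Bochner_Integration.integral_add) auto
    also have "(LINT w|lborel. (f (mv z r w))\<^sup>2) = (1 / r ^ ?Q) * (LINT z|lborel. (f z)\<^sup>2)"
      by (rule integral_mv[OF _ r0]) measurable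
    also have "r * ((1 / r ^ ?Q) * (LINT z|lborel. (f z)\<^sup>2)) \<le> (1 / r) * (LINT z|lborel. (f z)\<^sup>2)"
    proof -
      have "r * (1 / r ^ ?Q) = 1 / r * (1 / r ^ (4 * CARD('n)))"
        using r0 by (simp add: power_add power2_eq_square)
      also have "\<dots> \<le> 1 / r * 1"
        using r r0 by (intro mult_left_mono) (auto simp: one_le_power)
      finally show ?thesis
        unfolding mult.assoc[symmetric] by (intro mult_right_mono) auto
    qed
    finally show ?thesis by (simp add: E_def distrib_left distrib_right add_divide_distrib)
  qed
  then have ev: "eventually (\<lambda>r. norm (kin_mol f z r) \<le> E * (1 / r)) at_top"
    by (auto intro!: eventually_at_top_linorderI[of 1])
  have "((\<lambda>r :: real. E * (1 / r)) \<longlongrightarrow> 0) at_top"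
    using tendsto_mult[OF tendsto_const[of E] tendsto_inverse_0_at_top[OF filterlim_ident]] by (simp add: inverse_eq_divide)
  then show ?thesis
    by (rule Lim_null_comparison[OF ev])
qed

text \<open>Integrate the derivative from \<open>r\<close> to \<open>b\<close>, bound it by
  \<open>kin_avg\<close>, and let \<open>b\<close> tend to infinity, where the mollification
  vanishes. Extending the range to all positive scales makes the bound independent of
  \<open>r\<close>.\<close>

lemma kin_mol_bound:
  "\<exists>C\<ge>0. \<forall>(f :: 'n::finite phase \<Rightarrow> real) g S z r.
    L2 f \<and> L2v g \<and> weak_grad_v f g \<and> L2v S \<and> kinetic_eq f S \<and> r > 0 \<longrightarrow>
    ennreal \<bar>kin_mol f z r\<bar> \<le> ennreal C * kin_pot (\<lambda>u. ennreal (norm (g u) + norm (S u))) z"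
proof -
  obtain C where C: "C \<ge> 0" and *: "\<And>(f :: 'n phase \<Rightarrow> real) g S z r.
    L2 f \<Longrightarrow> L2v g \<Longrightarrow> weak_grad_v f g \<Longrightarrow> L2v S \<Longrightarrow> kinetic_eq f S \<Longrightarrow> r > 0 \<Longrightarrow>
    ennreal \<bar>LINT w|lborel. f (mv z r w) * profile w\<bar>
      \<le> ennreal (r * C) * kin_avg (\<lambda>u. ennreal (norm (g u) + norm (S u))) z r"
    using integral_profile_bound by blast
  show ?thesis
  proof (intro exI[of _ C] conjI allI impI C; elim conjE)
    fix f :: "'n phase \<Rightarrow> real" and g S z and r :: real
    assume f: "L2 f" and g: "L2v g" and fg: "weak_grad_v f g" and S: "L2v S" and fS: "kinetic_eq f S" and r: "0 < r"
    have [measurable]: "f \<in> borel_measurable borel" "g \<in> borel_measurable borel" "S \<in> borel_measurable borel"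
      using f g S by (auto simp: L2_def L2v_def)
    let ?h = "\<lambda>u. ennreal (norm (g u) + norm (S u))"
    let ?J = "\<lambda>b s. indicator {r..b} s * (- (1 / s)) * (LINT w|lborel. f (mv z s w) * profile w) :: real"
    have diff: "ennreal \<bar>kin_mol f z b - kin_mol f z r\<bar> \<le> ennreal C * kin_pot ?h z" if b: "r \<le> b" for b
    proof (cases "integrable lborel (?J b)")
      case True
      have "ennreal \<bar>kin_mol f z b - kin_mol f z r\<bar> \<le> (\<integral>\<^sup>+s. ennreal (norm (?J b s)) \<partial>lborel)"
        unfolding kin_mol_diff[OF f r b] using integral_norm_bound_ennreal[OF True] by simp
      also have "\<dots> \<le> (\<integral>\<^sup>+s. ennreal C * (kin_avg ?h z s * indicator {0<..} s) \<partial>lborel)"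
      proof (rule nn_integral_mono)
        fix s :: real
        show "ennreal (norm (?J b s)) \<le> ennreal C * (kin_avg ?h z s * indicator {0<..} s)"
        proof (cases "s \<in> {r..b}")
          case True
          then have s: "s > 0" using r by auto
          have "ennreal (norm (?J b s)) = ennreal (1 / s) * ennreal \<bar>LINT w|lborel. f (mv z s w) * profile w\<bar>"
            using True s by (simp add: abs_mult ennreal_mult[symmetric])
          also have "\<dots> \<le> ennreal (1 / s) * (ennreal (s * C) * kin_avg ?h z s)"
            by (intro mult_left_mono *[OF f g fg S fS s]) auto
          also have "\<dots> = ennreal C * kin_avg ?h z s"
            using s C by (simp add: mult.assoc[symmetric] ennreal_mult[symmetric])
          finally show ?thesis using s by simp
        qed simp
      qed
      also have "\<dots> = ennreal C * kin_pot ?h z"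
        unfolding kin_pot_def kin_avg_def by (rule nn_integral_cmult) measurable
      finally show ?thesis .
    next
      \<comment> \<open>The Bochner integral of a non-integrable function is 0 by convention, so
        \<open>kin_mol_diff\<close> then makes the difference itself 0.\<close>
      case False
      then show ?thesis
        unfolding kin_mol_diff[OF f r b] by (simp add: not_integrable_integral_eq)
    qed
    have "((\<lambda>b. ennreal \<bar>kin_mol f z b - kin_mol f z r\<bar>) \<longlongrightarrow> ennreal \<bar>0 - kin_mol f z r\<bar>) at_top"
      by (intro tendsto_ennrealI tendsto_intros kin_mol_decay f)
    then have "ennreal \<bar>0 - kin_mol f z r\<bar> \<le> ennreal C * kin_pot ?h z"
      by (rule tendsto_upperbound[OF _ eventually_mono[OF eventually_ge_at_top[of r] diff]]) simp_all
    then show "ennreal \<bar>kin_mol f z r\<bar> \<le> ennreal C * kin_pot ?h z" by simp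
  qed
qed

section \<open>A Hardy-Littlewood-Sobolev inequality for the kinetic potential\<close>

lemma kin_avg_measurable:
  fixes h :: "'n::finite phase \<Rightarrow> ennreal"
  assumes [measurable]: "h \<in> borel_measurable borel" "z \<in> borel_measurable M" "r \<in> borel_measurable M"
  shows "(\<lambda>x. kin_avg h (z x) (r x)) \<in> borel_measurable M"
  unfolding kin_avg_def by measurable

lemma kin_pot_measurable:
  fixes h :: "'n::finite phase \<Rightarrow> ennreal"
  assumes h: "h \<in> borel_measurable borel"
  shows "kin_pot h \<in> borel_measurable borel"
proof -
  have [measurable]: "(\<lambda>x. kin_avg h (fst x) (snd x)) \<in> borel_measurable (borel \<Otimes>\<^sub>M borel)"
    by (intro kin_avg_measurable[OF h]) measurable
  have "(\<lambda>(z, r). kin_avg h z r * indicator {0<..} r) \<in> borel_measurable (borel \<Otimes>\<^sub>M lborel)"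
    unfolding split_beta' by measurable
  then show ?thesis
    unfolding kin_pot_def[abs_def] by (rule lborel.borel_measurable_nn_integral)
qed

section \<open>Size of kinetic averages\<close>

abbreviation ball_vol :: "'n::finite itself \<Rightarrow> real" where
  "ball_vol _ \<equiv> measure lborel (cball (0 :: 'n phase) 1)"

lemma emeasure_unit_cball: "emeasure lborel (cball (0 :: 'n::finite phase) 1) = ennreal (ball_vol TYPE('n))"
  by (rule emeasure_eq_ennreal_measure) (metis emeasure_bounded_finite bounded_cball less_irrefl infinity_ennreal_def)

lemma kin_avg_le_const:
  fixes h :: "'n::finite phase \<Rightarrow> ennreal"
  assumes "\<And>u. h u \<le> s"
  shows "kin_avg h z r \<le> s * ennreal (ball_vol TYPE('n))"
proof -
  have "kin_avg h z r \<le> (\<integral>\<^sup>+w. s * indicator (cball (0 :: 'n phase) 1) w \<partial>lborel)"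
    unfolding kin_avg_def by (intro nn_integral_mono mult_right_mono assms) simp
  also have "\<dots> = s * ennreal (ball_vol TYPE('n))"
    by (subst nn_integral_cmult_indicator) (simp_all add: emeasure_unit_cball)
  finally show ?thesis .
qed

text \<open>For fixed \<open>w\<close> a right translation preserves Lebesgue measure, so the scale
  disappears after integration over \<open>z\<close>.\<close>

lemma nn_integral_kin_avg:
  fixes h :: "'n::finite phase \<Rightarrow> ennreal"
  assumes [measurable]: "h \<in> borel_measurable borel"
  shows "(\<integral>\<^sup>+z. kin_avg h z r \<partial>lborel) = ennreal (ball_vol TYPE('n)) * (\<integral>\<^sup>+z. h z \<partial>lborel)"
proof -
  have "(\<integral>\<^sup>+z. kin_avg h z r \<partial>lborel) = (\<integral>\<^sup>+w. \<integral>\<^sup>+z. h (mv z r w) * indicator (cball 0 1) w \<partial>lborel \<partial>lborel)"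
    unfolding kin_avg_def by (rule lborel_pair.Fubini') measurable
  also have "\<dots> = (\<integral>\<^sup>+w. (\<integral>\<^sup>+z. h z \<partial>lborel) * indicator (cball (0 :: 'n phase) 1) w \<partial>lborel)"
    by (subst nn_integral_multc, measurable) (simp add: nn_integral_mv_left)
  also have "\<dots> = (\<integral>\<^sup>+z. h z \<partial>lborel) * ennreal (ball_vol TYPE('n))"
    by (subst nn_integral_cmult_indicator) (simp_all add: emeasure_unit_cball)
  finally show ?thesis by (simp add: mult.commute)
qed

text \<open>Cauchy-Schwarz in linearised form: the integral of h^2 shrinks by r^-Q under the change
  of variables, and the square root of r^-Q is r^-(2 n + 1).\<close>

lemma kin_avg_decay:
  fixes h :: "'n::finite phase \<Rightarrow> real"
  assumes [measurable]: "h \<in> borel_measurable borel" and H: "(\<integral>\<^sup>+z. ennreal ((h z)\<^sup>2) \<partial>lborel) \<le> ennreal (H\<^sup>2)" "H > 0" and r: "r > 0"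
  shows "kin_avg (\<lambda>u. ennreal (h u)) z r \<le> ennreal ((1 + ball_vol TYPE('n)) * H * r powr - real (2 * CARD('n) + 1))"
proof -
  let ?m = "2 * CARD('n) + 1"
  \<comment> \<open>Balances the two terms of x <= \<theta> x^2 + 1/\<theta> after integration: both
    become H r^-(2 n + 1), up to the ball volume.\<close>
  define \<theta> where "\<theta> = r ^ ?m / H"
  have \<theta>: "\<theta> > 0" using H r by (simp add: \<theta>_def)
  have *: "x \<le> \<theta> * x\<^sup>2 + 1 / \<theta>" for x :: real
  proof -
    have "0 \<le> (\<theta> * \<bar>x\<bar> - 1)\<^sup>2" by simp
    then have "2 * (\<theta> * \<bar>x\<bar>) \<le> \<theta> * (\<theta> * x\<^sup>2) + 1"
      by (simp add: power2_diff power_mult_distrib) (simp add: power2_eq_square algebra_simps)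
    then have "2 * \<bar>x\<bar> \<le> \<theta> * x\<^sup>2 + 1 / \<theta>"
      using \<theta> by (simp add: field_simps)
    then show ?thesis by linarith
  qed
  have "kin_avg (\<lambda>u. ennreal (h u)) z r \<le> (\<integral>\<^sup>+w. ennreal \<theta> * ennreal ((h (mv z r w))\<^sup>2) + ennreal (1 / \<theta>) * indicator (cball 0 1) w \<partial>lborel)"
    unfolding kin_avg_def
  proof (rule nn_integral_mono)
    fix w :: "'n phase"
    have "ennreal (h (mv z r w)) \<le> ennreal (\<theta> * (h (mv z r w))\<^sup>2 + 1 / \<theta>)"
      by (intro ennreal_leI *)
    also have "\<dots> = ennreal \<theta> * ennreal ((h (mv z r w))\<^sup>2) + ennreal (1 / \<theta>)"
      using \<theta> by (simp add: ennreal_mult)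
    finally show "ennreal (h (mv z r w)) * indicator (cball 0 1) w \<le> ennreal \<theta> * ennreal ((h (mv z r w))\<^sup>2) + ennreal (1 / \<theta>) * indicator (cball 0 1) w"
      by (auto simp: indicator_def)
  qed
  also have "\<dots> = ennreal \<theta> * (\<integral>\<^sup>+w. ennreal ((h (mv z r w))\<^sup>2) \<partial>lborel) + ennreal (1 / \<theta>) * ennreal (ball_vol TYPE('n))"
    by (subst nn_integral_add, measurable, subst nn_integral_cmult, measurable, subst nn_integral_cmult_indicator) (simp_all add: emeasure_unit_cball)
  also have "\<dots> = ennreal \<theta> * (ennreal (1 / r ^ hdim TYPE('n)) * (\<integral>\<^sup>+z. ennreal ((h z)\<^sup>2) \<partial>lborel)) + ennreal (1 / \<theta>) * ennreal (ball_vol TYPE('n))"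
    by (subst nn_integral_mv_right[OF _ r]) auto
  also have "\<dots> \<le> ennreal \<theta> * (ennreal (1 / r ^ hdim TYPE('n)) * ennreal (H\<^sup>2)) + ennreal (1 / \<theta>) * ennreal (ball_vol TYPE('n))"
    by (intro add_mono mult_left_mono H) auto
  also have "\<dots> = ennreal (\<theta> * (1 / r ^ hdim TYPE('n) * H\<^sup>2) + 1 / \<theta> * ball_vol TYPE('n))"
    using \<theta> r by (simp add: ennreal_mult[symmetric] ennreal_plus[symmetric] del: ennreal_plus power_Suc power_add)
  also have "\<theta> * (1 / r ^ hdim TYPE('n) * H\<^sup>2) + 1 / \<theta> * ball_vol TYPE('n) = (1 + ball_vol TYPE('n)) * H * (1 / r ^ ?m)"
  proof -
    have "r ^ hdim TYPE('n) = r ^ ?m * r ^ ?m" by (simp add: power_add[symmetric] del: power_Suc)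
    then show ?thesis
      unfolding \<theta>_def using H r by (simp add: field_simps power2_eq_square del: power_Suc power_add)
  qed
  also have "1 / r ^ ?m = r powr - real ?m"
    unfolding powr_minus powr_realpow[OF r] by (simp only: divide_inverse mult_1)
  finally show ?thesis by simp
qed

lemma kin_avg_tail:
  fixes h :: "'n::finite phase \<Rightarrow> real"
  assumes [measurable]: "h \<in> borel_measurable borel" and H: "(\<integral>\<^sup>+z. ennreal ((h z)\<^sup>2) \<partial>lborel) \<le> ennreal (H\<^sup>2)" "H > 0" and \<rho>: "\<rho> > 0"
  shows "(\<integral>\<^sup>+r. kin_avg (\<lambda>u. ennreal (h u)) z r * indicator {\<rho>..} r \<partial>lborel)
    \<le> ennreal ((1 + ball_vol TYPE('n)) * H * \<rho> powr - (2 * CARD('n)))"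
proof -
  let ?c = "(1 + ball_vol TYPE('n)) * H"
  have c: "?c \<ge> 0" using H by simp
  have "(\<integral>\<^sup>+r. kin_avg (\<lambda>u. ennreal (h u)) z r * indicator {\<rho>..} r \<partial>lborel)
    \<le> (\<integral>\<^sup>+r. ennreal ?c * (ennreal (r powr - real (2 * CARD('n) + 1)) * indicator {\<rho>..} r) \<partial>lborel)"
  proof (rule nn_integral_mono)
    fix r :: real
    show "kin_avg (\<lambda>u. ennreal (h u)) z r * indicator {\<rho>..} r \<le> ennreal ?c * (ennreal (r powr - real (2 * CARD('n) + 1)) * indicator {\<rho>..} r)"
      using kin_avg_decay[OF assms(1) H, of r z] \<rho> c by (auto simp: indicator_def ennreal_mult[symmetric])
  qed
  also have "\<dots> = ennreal ?c * (\<integral>\<^sup>+r. ennreal (r powr - real (2 * CARD('n) + 1)) * indicator {\<rho>..} r \<partial>lborel)"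
    by (rule nn_integral_cmult) measurable
  also have "(\<integral>\<^sup>+r. ennreal (r powr - real (2 * CARD('n) + 1)) * indicator {\<rho>..} r \<partial>lborel) \<le> ennreal (\<rho> powr - (2 * CARD('n)))"
  proof -
    define e where "e = - real (2 * CARD('n) + 1)"
    have e: "e + 1 = - (2 * real CARD('n))" by (simp add: e_def)
    have "CARD('n) \<ge> 1" by (simp add: Suc_le_eq)
    then have "e + 1 \<le> - 1" unfolding e by linarith
    have "(\<integral>\<^sup>+r. ennreal (r powr e) * indicator {\<rho>..} r \<partial>lborel) = ennreal (- (\<rho> powr (e + 1)) / (e + 1))"
      using \<rho> \<open>e + 1 \<le> - 1\<close> by (intro nn_integral_has_integral_lebesgue' has_integral_powr_to_inf) auto
    also have "- (\<rho> powr (e + 1)) / (e + 1) = \<rho> powr (e + 1) / (- (e + 1))"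
      by (metis minus_divide_left minus_divide_right)
    also have "ennreal \<dots> \<le> ennreal (\<rho> powr (e + 1) / 1)"
      using \<open>e + 1 \<le> - 1\<close> by (intro ennreal_leI divide_left_mono) auto
    finally show ?thesis unfolding e_def[symmetric] e by simp
  qed
  finally show ?thesis
    using c by (simp add: ennreal_mult mult_left_mono)
qed

text \<open>The conditions \<open>tail\<close> and \<open>s\<close> let the large scales and the
  small values of \<open>h\<close> use up at most 3/4 of \<open>\<mu>\<close>; the remaining quarter
  must come from large values at small scales. Markov's inequality applies to that part because
  averaging preserves the L^1 norm up to the ball volume.\<close>

lemma kin_pot_level_set:
  fixes h :: "'n::finite phase \<Rightarrow> real"
  assumes [measurable]: "h \<in> borel_measurable borel" and H: "(\<integral>\<^sup>+z. ennreal ((h z)\<^sup>2) \<partial>lborel) \<le> ennreal (H\<^sup>2)" "H > 0"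
    and \<rho>: "\<rho> > 0" and \<mu>: "\<mu> > 0"
    and tail: "(1 + ball_vol TYPE('n)) * H * \<rho> powr - (2 * CARD('n)) \<le> \<mu> / 2"
    and s: "s \<ge> 0" "s * \<rho> * ball_vol TYPE('n) \<le> \<mu> / 4"
  shows "emeasure lborel {z. kin_pot (\<lambda>u. ennreal (h u)) z > ennreal \<mu>}
    \<le> ennreal (4 * \<rho> * ball_vol TYPE('n) / \<mu>) * (\<integral>\<^sup>+z. ennreal (h z) * indicator {z. h z > s} z \<partial>lborel)"
proof -
  let ?h = "\<lambda>u. ennreal (h u)"
  define big where "big u = ennreal (h u) * indicator {z. h z > s} u" for u
  define small where "small u = ennreal (h u) * indicator {z. h z \<le> s} u" for u
  have [measurable]: "big \<in> borel_measurable borel" "small \<in> borel_measurable borel"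
    unfolding big_def small_def by measurable
  have avg: "kin_avg ?h z r = kin_avg big z r + kin_avg small z r" for z r
    unfolding kin_avg_def
    by (subst nn_integral_add[symmetric], measurable, intro nn_integral_cong) (auto simp: big_def small_def indicator_def)
  have avg_meas [measurable]: "(\<lambda>r. kin_avg k z r) \<in> borel_measurable borel" if "k \<in> borel_measurable borel" for k :: "'n phase \<Rightarrow> ennreal" and z
    by (rule kin_avg_measurable[OF that]) measurable
  note [measurable] = avg_meas[of big] avg_meas[of small] avg_meas[of ?h]
  define U where "U z = (\<integral>\<^sup>+r. kin_avg big z r * indicator {0<..<\<rho>} r \<partial>lborel)" for z
  have [measurable]: "(\<lambda>(z, r). kin_avg big z r * indicator {0<..<\<rho>} r) \<in> borel_measurable (borel \<Otimes>\<^sub>M lborel)"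
  proof -
    have [measurable]: "(\<lambda>x. kin_avg big (fst x) (snd x)) \<in> borel_measurable (borel \<Otimes>\<^sub>M borel)"
      by (intro kin_avg_measurable) measurable
    show ?thesis unfolding split_beta' by measurable
  qed
  have U_meas [measurable]: "U \<in> borel_measurable borel"
    unfolding U_def[abs_def] by (rule lborel.borel_measurable_nn_integral) measurable
  have split: "kin_pot ?h z \<le> U z + ennreal (3 * \<mu> / 4)" for z
  proof -
    have "kin_pot ?h z \<le> (\<integral>\<^sup>+r. kin_avg big z r * indicator {0<..<\<rho>} r + (kin_avg small z r * indicator {0<..<\<rho>} r + kin_avg ?h z r * indicator {\<rho>..} r) \<partial>lborel)"
      unfolding kin_pot_def by (intro nn_integral_mono) (auto simp: indicator_def avg)
    also have "\<dots> = U z + ((\<integral>\<^sup>+r. kin_avg small z r * indicator {0<..<\<rho>} r \<partial>lborel) + (\<integral>\<^sup>+r. kin_avg ?h z r * indicator {\<rho>..} r \<partial>lborel))"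
      unfolding U_def by (subst nn_integral_add, measurable, subst nn_integral_add, measurable)
    also have "\<dots> \<le> U z + (ennreal (\<mu> / 4) + ennreal (\<mu> / 2))"
    proof (intro add_left_mono add_mono)
      have "(\<integral>\<^sup>+r. kin_avg small z r * indicator {0<..<\<rho>} r \<partial>lborel) \<le> (\<integral>\<^sup>+r. (ennreal s * ennreal (ball_vol TYPE('n))) * indicator {0<..<\<rho>} r \<partial>lborel)"
        by (intro nn_integral_mono mult_right_mono kin_avg_le_const) (auto simp: small_def indicator_def ennreal_leI)
      also have "\<dots> = ennreal (s * \<rho> * ball_vol TYPE('n))"
        using \<rho> s by (subst nn_integral_cmult_indicator) (auto simp: ennreal_mult[symmetric] ac_simps)
      also have "\<dots> \<le> ennreal (\<mu> / 4)" using s by (intro ennreal_leI)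
      finally show "(\<integral>\<^sup>+r. kin_avg small z r * indicator {0<..<\<rho>} r \<partial>lborel) \<le> ennreal (\<mu> / 4)" .
      show "(\<integral>\<^sup>+r. kin_avg ?h z r * indicator {\<rho>..} r \<partial>lborel) \<le> ennreal (\<mu> / 2)"
        using kin_avg_tail[OF assms(1) H \<rho>, of z] tail by (meson ennreal_leI order_trans)
    qed
    also have "ennreal (\<mu> / 4) + ennreal (\<mu> / 2) = ennreal (3 * \<mu> / 4)"
      using \<mu> by (simp add: ennreal_plus[symmetric] del: ennreal_plus)
    finally show ?thesis .
  qed
  have "{z. kin_pot ?h z > ennreal \<mu>} \<subseteq> {z \<in> UNIV. 1 \<le> ennreal (4 / \<mu>) * U z}"
  proof safe
    fix z assume z: "ennreal \<mu> < kin_pot ?h z"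
    have "ennreal (\<mu> / 4) \<le> U z"
    proof (rule ccontr)
      assume "\<not> ?thesis"
      then have "U z + ennreal (3 * \<mu> / 4) \<le> ennreal (\<mu> / 4) + ennreal (3 * \<mu> / 4)"
        by (intro add_right_mono) auto
      also have "\<dots> = ennreal \<mu>"
        using \<mu> by (simp add: ennreal_plus[symmetric] del: ennreal_plus)
      finally show False using split[of z] z by (meson leD order_trans)
    qed
    then have "ennreal (4 / \<mu>) * ennreal (\<mu> / 4) \<le> ennreal (4 / \<mu>) * U z"
      by (rule mult_left_mono) simp
    then show "1 \<le> ennreal (4 / \<mu>) * U z"
      using \<mu> by (simp add: ennreal_mult[symmetric])
  qed simp
  then have "emeasure lborel {z. kin_pot ?h z > ennreal \<mu>} \<le> emeasure lborel ({z \<in> UNIV. 1 \<le> ennreal (4 / \<mu>) * U z})"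
    by (intro emeasure_mono) measurable
  also have "\<dots> \<le> ennreal (4 / \<mu>) * (\<integral>\<^sup>+z. U z * indicator UNIV z \<partial>lborel)"
    by (rule nn_integral_Markov_inequality) measurable
  \<comment> \<open>Integrating over \<open>z\<close> first makes the inner integral independent of
    \<open>r\<close>; the scales below \<open>\<rho>\<close> then contribute the factor
    \<open>\<rho>\<close>.\<close>
  also have "(\<integral>\<^sup>+z. U z * indicator UNIV z \<partial>lborel) = (\<integral>\<^sup>+r. \<integral>\<^sup>+z. kin_avg big z r * indicator {0<..<\<rho>} r \<partial>lborel \<partial>lborel)"
  proof -
    have "(\<lambda>(r, z). kin_avg big z r * indicator {0<..<\<rho>} r) \<in> borel_measurable (lborel \<Otimes>\<^sub>M lborel)"
      unfolding split_beta' by (intro borel_measurable_times_ennreal kin_avg_measurable) measurable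
    from lborel_pair.Fubini'[OF this] show ?thesis unfolding U_def by simp
  qed
  also have "\<dots> = (\<integral>\<^sup>+r. (ennreal (ball_vol TYPE('n)) * (\<integral>\<^sup>+z. big z \<partial>lborel)) * indicator {0<..<\<rho>} r \<partial>lborel)"
    by (subst nn_integral_multc) (auto simp: nn_integral_kin_avg kin_avg_measurable)
  also have "\<dots> = ennreal (ball_vol TYPE('n)) * (\<integral>\<^sup>+z. big z \<partial>lborel) * ennreal \<rho>"
    using \<rho> by (subst nn_integral_cmult_indicator) auto
  also have "ennreal (4 / \<mu>) * (ennreal (ball_vol TYPE('n)) * (\<integral>\<^sup>+z. big z \<partial>lborel) * ennreal \<rho>) = ennreal (4 * \<rho> * ball_vol TYPE('n) / \<mu>) * (\<integral>\<^sup>+z. big z \<partial>lborel)"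
  proof -
    have "4 * \<rho> * ball_vol TYPE('n) / \<mu> = 4 / \<mu> * ball_vol TYPE('n) * \<rho>" by simp
    then have "ennreal (4 * \<rho> * ball_vol TYPE('n) / \<mu>) = ennreal (4 / \<mu>) * ennreal (ball_vol TYPE('n)) * ennreal \<rho>"
      using \<rho> \<mu> ennreal_mult[of "4 / \<mu> * ball_vol TYPE('n)" \<rho>] ennreal_mult[of "4 / \<mu>" "ball_vol TYPE('n)"]
      by (simp only: mult_nonneg_nonneg divide_nonneg_nonneg measure_nonneg less_imp_le zero_le_numeral)
    then show ?thesis by (simp only: mult_ac)
  qed
  finally show ?thesis unfolding big_def .
qed

section \<open>From level sets to the L^p norm\<close>

lemma nn_integral_powr_from_0:
  fixes a c :: real
  assumes "a > -1" "c \<ge> 0"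
  shows "(\<integral>\<^sup>+t. ennreal (t powr a) * indicator {0<..<c} t \<partial>lborel) = ennreal (c powr (a + 1) / (a + 1))"
proof -
  have "(\<integral>\<^sup>+t. ennreal (t powr a) * indicator {0<..<c} t \<partial>lborel) = (\<integral>\<^sup>+t. ennreal (t powr a) * indicator {0..c} t \<partial>lborel)"
    by (intro nn_integral_cong_AE eventually_mono[OF eventually_conj[OF AE_lborel_singleton[of 0] AE_lborel_singleton[of c]]])
       (auto simp: indicator_def)
  also have "\<dots> = ennreal (c powr (a + 1) / (a + 1))"
    by (intro nn_integral_has_integral_lebesgue' has_integral_powr_from_0 assms) simp
  finally show ?thesis .
qed

lemma layer_cake_powr:
  fixes f :: "'a::euclidean_space \<Rightarrow> real"
  assumes [measurable]: "f \<in> borel_measurable borel" and p: "p > 0"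
  shows "(\<integral>\<^sup>+z. ennreal (\<bar>f z\<bar> powr p) \<partial>lborel)
    = (\<integral>\<^sup>+t. ennreal (p * t powr (p - 1)) * indicator {0<..} t * emeasure lborel {z. \<bar>f z\<bar> > t} \<partial>lborel)"
proof -
  have "ennreal (\<bar>f z\<bar> powr p) = (\<integral>\<^sup>+t. ennreal (p * t powr (p - 1)) * indicator {0<..} t * indicator {z. \<bar>f z\<bar> > t} z \<partial>lborel)" for z
  proof -
    have "(\<integral>\<^sup>+t. ennreal (p * t powr (p - 1)) * indicator {0<..} t * indicator {z. \<bar>f z\<bar> > t} z \<partial>lborel)
      = (\<integral>\<^sup>+t. ennreal p * (ennreal (t powr (p - 1)) * indicator {0<..<\<bar>f z\<bar>} t) \<partial>lborel)"
      using p by (intro nn_integral_cong) (auto simp: indicator_def ennreal_mult)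
    also have "\<dots> = ennreal p * ennreal (\<bar>f z\<bar> powr (p - 1 + 1) / (p - 1 + 1))"
      using p by (subst nn_integral_cmult, measurable, subst nn_integral_powr_from_0) auto
    also have "\<dots> = ennreal (\<bar>f z\<bar> powr p)"
      using p by (simp add: ennreal_mult[symmetric])
    finally show ?thesis by simp
  qed
  then have "(\<integral>\<^sup>+z. ennreal (\<bar>f z\<bar> powr p) \<partial>lborel)
    = (\<integral>\<^sup>+z. \<integral>\<^sup>+t. ennreal (p * t powr (p - 1)) * indicator {0<..} t * indicator {z. \<bar>f z\<bar> > t} z \<partial>lborel \<partial>lborel)"
    by simp
  also have "\<dots> = (\<integral>\<^sup>+t. \<integral>\<^sup>+z. ennreal (p * t powr (p - 1)) * indicator {0<..} t * indicator {z. \<bar>f z\<bar> > t} z \<partial>lborel \<partial>lborel)"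
    by (rule lborel_pair.Fubini') (simp add: indicator_def split_beta')
  also have "\<dots> = (\<integral>\<^sup>+t. ennreal (p * t powr (p - 1)) * indicator {0<..} t * emeasure lborel {z. \<bar>f z\<bar> > t} \<partial>lborel)"
    by (subst nn_integral_cmult_indicator) auto
  finally show ?thesis .
qed

text \<open>The level set bound enters the layer-cake formula with a cutoff radius that depends on
  the level. For p = 2 (1 + \<alpha>) the weight t^(p - 1) \<rho>(t) / t is proportional to
  t^\<alpha>, on the range s(t) < h. As s(t) is proportional to t^(1 + \<alpha>), the t-integral is
  proportional to h, and the factor h outside makes h^2.\<close>

lemma kin_pot_powr_bound:
  fixes h f :: "'n::finite phase \<Rightarrow> real"
  assumes [measurable]: "h \<in> borel_measurable borel" "f \<in> borel_measurable borel"
    and h0: "\<And>z. h z \<ge> 0"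
    and H: "(\<integral>\<^sup>+z. ennreal ((h z)\<^sup>2) \<partial>lborel) \<le> ennreal (H\<^sup>2)" "H > 0"
    and fh: "AE z in lborel. ennreal \<bar>f z\<bar> \<le> kin_pot (\<lambda>u. ennreal (h u)) z"
  defines "\<alpha> \<equiv> 1 / (2 * real CARD('n))" and "\<beta> \<equiv> ball_vol TYPE('n)"
  shows "(\<integral>\<^sup>+z. ennreal (\<bar>f z\<bar> powr (2 * (1 + \<alpha>))) \<partial>lborel)
    \<le> ennreal (32 * \<beta>\<^sup>2 * (2 * (1 + \<beta>)) powr (2 * \<alpha>) * H powr (2 * (1 + \<alpha>)))"
proof -
  let ?p = "2 * (1 + \<alpha>)"
  have \<alpha>: "\<alpha> > 0" by (simp add: \<alpha>_def)
  have \<beta>: "\<beta> > 0" by (simp add: \<beta>_def)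
  \<comment> \<open>\<open>c\<close> and \<open>\<rho>\<close> make the tail condition an equality
    with t / 2, and \<open>s\<close> makes the bound for the small values exactly t / 4. Here
    \<open>\<kappa>\<close> is the prefactor of the radius, not the exponent of the theorem.\<close>
  define c where "c = 2 * (1 + \<beta>) * H"
  define \<kappa> where "\<kappa> = c powr \<alpha>"
  define \<rho> where "\<rho> t = \<kappa> * t powr - \<alpha>" for t
  define s where "s t = t / (4 * \<beta> * \<rho> t)" for t
  have c: "c > 0" using H \<beta> by (simp add: c_def)
  then have \<kappa>: "\<kappa> > 0" by (simp add: \<kappa>_def)
  have [measurable]: "s \<in> borel_measurable borel" "\<rho> \<in> borel_measurable borel"
    unfolding s_def[abs_def] \<rho>_def[abs_def] by measurable
  note [measurable] = kin_pot_measurable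
  have level: "emeasure lborel {z. \<bar>f z\<bar> > t}
      \<le> ennreal (4 * \<rho> t * \<beta> / t) * (\<integral>\<^sup>+z. ennreal (h z) * indicator {z. h z > s t} z \<partial>lborel)" if t: "t > 0" for t
  proof -
    have \<rho>: "\<rho> t > 0" using t \<kappa> by (simp add: \<rho>_def)
    have "emeasure lborel {z. \<bar>f z\<bar> > t} \<le> emeasure lborel {z. kin_pot (\<lambda>u. ennreal (h u)) z > ennreal t}"
    proof (rule emeasure_mono_AE)
      show "AE z in lborel. z \<in> {z. t < \<bar>f z\<bar>} \<longrightarrow> z \<in> {z. ennreal t < kin_pot (\<lambda>u. ennreal (h u)) z}"
        using fh
      proof (rule eventually_mono, safe)
        fix z assume z: "ennreal \<bar>f z\<bar> \<le> kin_pot (\<lambda>u. ennreal (h u)) z" "t < \<bar>f z\<bar>"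
        then have "ennreal t < ennreal \<bar>f z\<bar>" using t by (simp add: ennreal_less_iff)
        with z show "ennreal t < kin_pot (\<lambda>u. ennreal (h u)) z" by simp
      qed
    qed measurable
    also have "\<dots> \<le> ennreal (4 * \<rho> t * \<beta> / t) * (\<integral>\<^sup>+z. ennreal (h z) * indicator {z. h z > s t} z \<partial>lborel)"
      unfolding \<beta>_def
    proof (rule kin_pot_level_set[OF _ H \<rho> t])
      have "\<rho> t powr - (2 * CARD('n)) = \<kappa> powr - (2 * real CARD('n)) * t powr (\<alpha> * (2 * real CARD('n)))"
        unfolding \<rho>_def using t \<kappa> by (simp add: powr_mult powr_powr)
      also have "\<kappa> powr - (2 * real CARD('n)) = 1 / c"
      proof -
        have "\<alpha> * - (2 * real CARD('n)) = - 1" by (simp add: \<alpha>_def)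
        then show ?thesis
          unfolding \<kappa>_def powr_powr using c by (simp only: powr_minus_divide powr_one)
      qed
      also have "\<alpha> * (2 * real CARD('n)) = 1" by (simp add: \<alpha>_def)
      finally have "(1 + \<beta>) * H * \<rho> t powr - (2 * CARD('n)) = t / 2"
        using t c H \<beta> unfolding c_def by (simp add: field_simps)
      then show "(1 + ball_vol TYPE('n)) * H * \<rho> t powr - (2 * CARD('n)) \<le> t / 2"
        unfolding \<beta>_def by simp
      show "0 \<le> s t" using t \<beta> \<rho> by (simp add: s_def)
      show "s t * \<rho> t * ball_vol TYPE('n) \<le> t / 4"
        using t \<beta> \<rho> unfolding \<beta>_def[symmetric] by (simp add: s_def)
    qed simp
    finally show ?thesis .
  qed
  \<comment> \<open>Inverts the increasing function \<open>s\<close>, so that for fixed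
    \<open>z\<close> the range of \<open>t\<close> is an interval starting at 0.\<close>
  have s_less: "s t < y \<longleftrightarrow> t < (4 * \<beta> * \<kappa> * y) powr (1 / (1 + \<alpha>))" if t: "t > 0" and y: "y \<ge> 0" for t y
  proof -
    have "s t = t powr (1 + \<alpha>) / (4 * \<beta> * \<kappa>)"
      using t \<kappa> \<beta> by (simp add: s_def \<rho>_def powr_add powr_minus field_simps)
    then have "s t < y \<longleftrightarrow> t powr (1 + \<alpha>) < 4 * \<beta> * \<kappa> * y"
      using \<kappa> \<beta> by (simp only: pos_divide_less_eq mult_pos_pos zero_less_numeral) (simp only: mult_ac)
    also have "4 * \<beta> * \<kappa> * y = ((4 * \<beta> * \<kappa> * y) powr (1 / (1 + \<alpha>))) powr (1 + \<alpha>)"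
      using \<kappa> \<beta> y \<alpha> by (simp add: powr_powr)
    also have "t powr (1 + \<alpha>) < \<dots> \<longleftrightarrow> t < (4 * \<beta> * \<kappa> * y) powr (1 / (1 + \<alpha>))"
      using t \<alpha> powr_less_mono2[of "1 + \<alpha>" t "(4 * \<beta> * \<kappa> * y) powr (1 / (1 + \<alpha>))"]
        powr_mono2[of "1 + \<alpha>" "(4 * \<beta> * \<kappa> * y) powr (1 / (1 + \<alpha>))" t]
      by (cases "t < (4 * \<beta> * \<kappa> * y) powr (1 / (1 + \<alpha>))") (auto simp: not_less)
    finally show ?thesis .
  qed
  let ?G = "\<lambda>t z. ennreal (h z) * (ennreal (4 * ?p * \<beta> * \<kappa> * t powr \<alpha>) * indicator {0<..} t * indicator {z. h z > s t} z)"
  have "(\<integral>\<^sup>+z. ennreal (\<bar>f z\<bar> powr ?p) \<partial>lborel)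
    = (\<integral>\<^sup>+t. ennreal (?p * t powr (?p - 1)) * indicator {0<..} t * emeasure lborel {z. \<bar>f z\<bar> > t} \<partial>lborel)"
    using \<alpha> by (intro layer_cake_powr) auto
  also have "\<dots> \<le> (\<integral>\<^sup>+t. \<integral>\<^sup>+z. ?G t z \<partial>lborel \<partial>lborel)"
  proof (rule nn_integral_mono)
    fix t :: real
    show "ennreal (?p * t powr (?p - 1)) * indicator {0<..} t * emeasure lborel {z. \<bar>f z\<bar> > t} \<le> (\<integral>\<^sup>+z. ?G t z \<partial>lborel)"
    proof (cases "t > 0")
      case t: True
      have "?p * t powr (?p - 1) * (4 * \<rho> t * \<beta> / t) = 4 * ?p * \<beta> * \<kappa> * (t powr (?p - 1) * t powr - \<alpha> * t powr - 1)"
        using t by (simp add: \<rho>_def powr_minus divide_inverse)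
      also have "t powr (?p - 1) * t powr - \<alpha> * t powr - 1 = t powr \<alpha>"
      proof -
        have "?p - 1 + - \<alpha> + - 1 = \<alpha>" by simp
        then show ?thesis by (simp only: powr_add[symmetric])
      qed
      finally have e: "?p * t powr (?p - 1) * (4 * \<rho> t * \<beta> / t) = 4 * ?p * \<beta> * \<kappa> * t powr \<alpha>" .
      have "ennreal (?p * t powr (?p - 1)) * emeasure lborel {z. \<bar>f z\<bar> > t}
        \<le> ennreal (?p * t powr (?p - 1)) * (ennreal (4 * \<rho> t * \<beta> / t) * (\<integral>\<^sup>+z. ennreal (h z) * indicator {z. h z > s t} z \<partial>lborel))"
        by (intro mult_left_mono level t) simp
      also have "\<dots> = ennreal (4 * ?p * \<beta> * \<kappa> * t powr \<alpha>) * (\<integral>\<^sup>+z. ennreal (h z) * indicator {z. h z > s t} z \<partial>lborel)"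
      proof -
        have "0 \<le> ?p * t powr (?p - 1)" "0 \<le> 4 * \<rho> t * \<beta> / t"
          using t \<beta> \<kappa> \<alpha> by (simp_all add: \<rho>_def)
        from ennreal_mult[OF this] show ?thesis unfolding e by (simp only: mult.assoc)
      qed
      also have "\<dots> = (\<integral>\<^sup>+z. ?G t z \<partial>lborel)"
        using t by (subst nn_integral_cmult[symmetric]) (auto simp: ac_simps)
      finally show ?thesis using t by simp
    qed simp
  qed
  also have "\<dots> = (\<integral>\<^sup>+z. \<integral>\<^sup>+t. ?G t z \<partial>lborel \<partial>lborel)"
    by (rule lborel_pair.Fubini') (simp add: indicator_def split_beta')
  also have "\<dots> = (\<integral>\<^sup>+z. ennreal (32 * \<beta>\<^sup>2 * \<kappa>\<^sup>2) * ennreal ((h z)\<^sup>2) \<partial>lborel)"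
  proof (rule nn_integral_cong)
    fix z :: "'n phase"
    let ?L = "(4 * \<beta> * \<kappa> * h z) powr (1 / (1 + \<alpha>))"
    have "(\<integral>\<^sup>+t. ?G t z \<partial>lborel) = (\<integral>\<^sup>+t. ennreal (h z * (4 * ?p * \<beta> * \<kappa>)) * (ennreal (t powr \<alpha>) * indicator {0<..<?L} t) \<partial>lborel)"
      using s_less[OF _ h0[of z]] h0[of z] \<alpha> \<beta> \<kappa>
      by (intro nn_integral_cong) (auto simp: indicator_def ennreal_mult[symmetric] mult.assoc)
    also have "\<dots> = ennreal (h z * (4 * ?p * \<beta> * \<kappa>)) * ennreal (?L powr (\<alpha> + 1) / (\<alpha> + 1))"
      using \<alpha> by (subst nn_integral_cmult, measurable, subst nn_integral_powr_from_0) auto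
    also have "?L powr (\<alpha> + 1) = 4 * \<beta> * \<kappa> * h z"
      using h0[of z] \<beta> \<kappa> \<alpha> by (simp add: powr_powr add.commute)
    \<comment> \<open>The constant 32 is free of \<alpha>: the factor 1 + \<alpha> of the exponent
      \<open>?p\<close> cancels against the 1 / (1 + \<alpha>) of the primitive.\<close>
    also have "ennreal (h z * (4 * ?p * \<beta> * \<kappa>)) * ennreal (4 * \<beta> * \<kappa> * h z / (\<alpha> + 1)) = ennreal (32 * \<beta>\<^sup>2 * \<kappa>\<^sup>2) * ennreal ((h z)\<^sup>2)"
      using h0[of z] \<beta> \<kappa> \<alpha> by (simp add: ennreal_mult[symmetric]) (simp add: field_simps power2_eq_square)
    finally show "(\<integral>\<^sup>+t. ?G t z \<partial>lborel) = ennreal (32 * \<beta>\<^sup>2 * \<kappa>\<^sup>2) * ennreal ((h z)\<^sup>2)" .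
  qed
  also have "\<dots> \<le> ennreal (32 * \<beta>\<^sup>2 * \<kappa>\<^sup>2) * ennreal (H\<^sup>2)"
    by (subst nn_integral_cmult) (auto intro!: mult_left_mono H)
  also have "\<dots> = ennreal (32 * \<beta>\<^sup>2 * (2 * (1 + \<beta>)) powr (2 * \<alpha>) * H powr (2 * (1 + \<alpha>)))"
  proof -
    have "\<kappa>\<^sup>2 = c powr (2 * \<alpha>)"
      unfolding \<kappa>_def by (simp add: power2_eq_square powr_add[symmetric])
    also have "\<dots> = (2 * (1 + \<beta>)) powr (2 * \<alpha>) * H powr (2 * \<alpha>)"
      unfolding c_def using H \<beta> by (intro powr_mult)
    moreover have "H powr (2 * (1 + \<alpha>)) = H powr (2 * \<alpha>) * H\<^sup>2"
      using H by (simp add: powr_add[symmetric] powr_numeral[symmetric] algebra_simps del: powr_numeral)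
    ultimately show ?thesis
      by (simp add: ennreal_mult[symmetric] ac_simps)
  qed
  finally show ?thesis .
qed

section \<open>Convergence of the mollification\<close>

text \<open>Two approximations, both by dominated convergence: truncate \<open>f\<close> in height
  and space, then replace the truncation by continuous functions. The latter converge only almost
  everywhere and without bounds, so they are cut off and clamped below a common dominating function,
  which does not change the limit.\<close>

lemma L2_continuous_approx:
  fixes f :: "'n::finite phase \<Rightarrow> real"
  assumes f: "L2 f" and \<eta>: "\<eta> > 0"
  obtains \<phi> where "continuous_on UNIV \<phi>" "(\<integral>\<^sup>+z. ennreal ((f z - \<phi> z)\<^sup>2) \<partial>lborel) \<le> ennreal \<eta>"
proof -
  have [measurable]: "f \<in> borel_measurable borel" using f by (simp add: L2_def)
  have [measurable]: "ball (0 :: 'n phase) r \<in> sets borel" for r by simp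
  have f2: "(\<integral>\<^sup>+z. ennreal ((f z)\<^sup>2) \<partial>lborel) < \<infinity>"
    using f by (auto simp: L2_def integrable_iff_bounded)
  define clamp where "clamp k y = max (- real k) (min (real k) y)" for k :: nat and y :: real
  define F where "F k z = indicator (ball 0 (real k)) z * clamp k (f z)" for k :: nat and z
  have [measurable]: "F k \<in> borel_measurable borel" for k
    unfolding F_def[abs_def] clamp_def
    by (intro borel_measurable_times borel_measurable_indicator borel_measurable_max borel_measurable_min borel_measurable_const) auto
  have "(\<lambda>k. \<integral>\<^sup>+z. ennreal ((f z - F k z)\<^sup>2) \<partial>lborel) \<longlonglongrightarrow> (\<integral>\<^sup>+z. 0 \<partial>(lborel :: 'n phase measure))"
  proof (rule nn_integral_dominated_convergence[where w="\<lambda>z. ennreal ((f z)\<^sup>2)"])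
    show "AE z in lborel. ennreal ((f z - F k z)\<^sup>2) \<le> ennreal ((f z)\<^sup>2)" for k
    proof (intro AE_I2 ennreal_leI)
      fix z
      have "\<bar>f z - F k z\<bar> \<le> \<bar>f z\<bar>"
        by (auto simp: F_def clamp_def indicator_def)
      then show "(f z - F k z)\<^sup>2 \<le> (f z)\<^sup>2" by (simp add: abs_le_square_iff)
    qed
    show "AE z in lborel. (\<lambda>k. ennreal ((f z - F k z)\<^sup>2)) \<longlonglongrightarrow> 0"
    proof (intro AE_I2 tendsto_eventually)
      fix z :: "'n phase"
      obtain k0 :: nat where k0: "max (norm z + 1) \<bar>f z\<bar> \<le> real k0"
        using real_arch_simple by blast
      have "ennreal ((f z - F k z)\<^sup>2) = 0" if "k \<ge> k0" for k
      proof -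
        have "norm z < real k" "\<bar>f z\<bar> \<le> real k" using k0 that by auto
        then show ?thesis by (simp add: F_def clamp_def)
      qed
      then show "\<forall>\<^sub>F k in sequentially. ennreal ((f z - F k z)\<^sup>2) = 0"
        unfolding eventually_sequentially by blast
    qed
  qed (use f2 in auto)
  \<comment> \<open>A quarter of the tolerance for each approximation, because (a + b)^2 <= 2 a^2 +
    2 b^2.\<close>
  then have "\<forall>\<^sub>F k in sequentially. (\<integral>\<^sup>+z. ennreal ((f z - F k z)\<^sup>2) \<partial>lborel) < ennreal (\<eta> / 4)"
    using \<eta> by (intro order_tendstoD(2)) auto
  then obtain k where k: "(\<integral>\<^sup>+z. ennreal ((f z - F k z)\<^sup>2) \<partial>lborel) < ennreal (\<eta> / 4)"
    by (auto simp: eventually_sequentially)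
  \<comment> \<open>\<open>measurable_on\<close> means being a pointwise limit of continuous
    functions off a negligible set.\<close>
  have "F k measurable_on UNIV"
    by (intro lebesgue_measurable_imp_measurable_on_real measurable_completion) auto
  then obtain N g where N: "negligible N" and g: "\<And>j. continuous_on UNIV (g j)"
    and lim: "\<And>z. z \<notin> N \<Longrightarrow> (\<lambda>j. g j z) \<longlonglongrightarrow> F k z"
    by (auto simp: measurable_on_def)
  define cut where "cut z = max 0 (min 1 (real k + 1 - norm z))" for z :: "'n phase"
  define \<psi> where "\<psi> j z = cut z * clamp k (g j z)" for j :: nat and z
  have cont: "continuous_on UNIV (\<psi> j)" for j
    unfolding \<psi>_def[abs_def] cut_def clamp_def by (intro continuous_intros g)
  then have [measurable]: "\<psi> j \<in> borel_measurable borel" for j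
    by (rule borel_measurable_continuous_onI)
  have bd: "\<bar>F k z - \<psi> j z\<bar> \<le> 2 * real k * indicator (ball 0 (real k + 1)) z" for j z
  proof (cases "norm z < real k + 1")
    case True
    have "\<bar>F k z\<bar> \<le> real k" by (auto simp: F_def clamp_def indicator_def)
    moreover have "\<bar>\<psi> j z\<bar> \<le> 1 * real k"
      unfolding \<psi>_def abs_mult by (intro mult_mono) (auto simp: cut_def clamp_def)
    ultimately show ?thesis using True by simp
  next
    case False
    then show ?thesis by (simp add: F_def \<psi>_def cut_def)
  qed
  have "(\<lambda>j. \<integral>\<^sup>+z. ennreal ((F k z - \<psi> j z)\<^sup>2) \<partial>lborel) \<longlonglongrightarrow> (\<integral>\<^sup>+z. 0 \<partial>(lborel :: 'n phase measure))"
  proof (rule nn_integral_dominated_convergence[where w="\<lambda>z. ennreal ((2 * real k)\<^sup>2) * indicator (ball 0 (real k + 1)) z"])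
    show "AE z in lborel. ennreal ((F k z - \<psi> j z)\<^sup>2) \<le> ennreal ((2 * real k)\<^sup>2) * indicator (ball 0 (real k + 1)) z" for j
    proof (rule AE_I2)
      fix z
      have "(F k z - \<psi> j z)\<^sup>2 \<le> (2 * real k * indicator (ball 0 (real k + 1)) z)\<^sup>2"
        using bd[of z j] by (intro power2_le_iff_abs_le[THEN iffD2]) auto
      then show "ennreal ((F k z - \<psi> j z)\<^sup>2) \<le> ennreal ((2 * real k)\<^sup>2) * indicator (ball 0 (real k + 1)) z"
        by (cases "z \<in> ball 0 (real k + 1)") (auto intro: ennreal_leI)
    qed
    have "emeasure lborel (ball (0 :: 'n phase) (real k + 1)) < \<infinity>"
      by (intro emeasure_bounded_finite) simp
    then show "(\<integral>\<^sup>+z. ennreal ((2 * real k)\<^sup>2) * indicator (ball (0 :: 'n phase) (real k + 1)) z \<partial>lborel) < \<infinity>"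
      by (subst nn_integral_cmult_indicator) (auto simp: ennreal_mult_less_top)
    have "AE z in lebesgue. z \<notin> N"
      using N by (simp add: AE_not_in negligible_iff_null_sets)
    then have "AE z in lborel. z \<notin> N"
      by (simp add: AE_completion_iff)
    then show "AE z in lborel. (\<lambda>j. ennreal ((F k z - \<psi> j z)\<^sup>2)) \<longlonglongrightarrow> 0"
    proof (rule eventually_mono)
      fix z assume "z \<notin> N"
      \<comment> \<open>\<open>cut\<close> is 1 on the ball carrying \<open>F k\<close>, whose
        values already lie in the clamping range.\<close>
      have *: "cut z * clamp k (F k z) = F k z"
        by (auto simp: F_def cut_def clamp_def indicator_def)
      have "(\<lambda>j. (F k z - cut z * clamp k (g j z))\<^sup>2) \<longlonglongrightarrow> (F k z - cut z * clamp k (F k z))\<^sup>2"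
        unfolding clamp_def by (intro tendsto_intros lim \<open>z \<notin> N\<close>)
      then have "(\<lambda>j. (F k z - \<psi> j z)\<^sup>2) \<longlonglongrightarrow> 0"
        unfolding * \<psi>_def by simp
      then show "(\<lambda>j. ennreal ((F k z - \<psi> j z)\<^sup>2)) \<longlonglongrightarrow> 0"
        using tendsto_ennrealI by fastforce
    qed
  qed auto
  then have "\<forall>\<^sub>F j in sequentially. (\<integral>\<^sup>+z. ennreal ((F k z - \<psi> j z)\<^sup>2) \<partial>lborel) < ennreal (\<eta> / 4)"
    using \<eta> by (intro order_tendstoD(2)) auto
  then obtain j where j: "(\<integral>\<^sup>+z. ennreal ((F k z - \<psi> j z)\<^sup>2) \<partial>lborel) < ennreal (\<eta> / 4)"
    by (auto simp: eventually_sequentially)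
  have "(\<integral>\<^sup>+z. ennreal ((f z - \<psi> j z)\<^sup>2) \<partial>lborel)
    \<le> (\<integral>\<^sup>+z. 2 * ennreal ((f z - F k z)\<^sup>2) + 2 * ennreal ((F k z - \<psi> j z)\<^sup>2) \<partial>lborel)"
  proof (rule nn_integral_mono)
    fix z
    have "(f z - \<psi> j z)\<^sup>2 \<le> 2 * (f z - F k z)\<^sup>2 + 2 * (F k z - \<psi> j z)\<^sup>2"
      using sum_squares_bound[of "f z - F k z" "F k z - \<psi> j z"]
      by (simp add: power2_eq_square algebra_simps)
    then show "ennreal ((f z - \<psi> j z)\<^sup>2) \<le> 2 * ennreal ((f z - F k z)\<^sup>2) + 2 * ennreal ((F k z - \<psi> j z)\<^sup>2)"
      by (simp add: ennreal_plus[symmetric] ennreal_leI ennreal_numeral[symmetric] ennreal_mult[symmetric] del: ennreal_plus ennreal_numeral)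
  qed
  also have "\<dots> = 2 * (\<integral>\<^sup>+z. ennreal ((f z - F k z)\<^sup>2) \<partial>lborel) + 2 * (\<integral>\<^sup>+z. ennreal ((F k z - \<psi> j z)\<^sup>2) \<partial>lborel)"
    by (simp add: nn_integral_add nn_integral_cmult)
  also have "\<dots> \<le> 2 * ennreal (\<eta> / 4) + 2 * ennreal (\<eta> / 4)"
    using k j by (intro add_mono mult_left_mono) auto
  also have "\<dots> = ennreal \<eta>"
  proof -
    have "2 * ennreal (\<eta> / 4) = ennreal (\<eta> / 2)"
      using \<eta> by (simp add: ennreal_numeral[symmetric] ennreal_mult[symmetric] del: ennreal_numeral)
    then show ?thesis using \<eta> by (simp add: ennreal_plus[symmetric] del: ennreal_plus)
  qed
  finally show ?thesis using that cont by blast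
qed

section \<open>Behaviour of the mollification as the scale tends to 0\<close>

lemma bump_nonneg: "0 \<le> bump 1 z" and bump_le: "bump 1 z \<le> indicator (cball 0 1) z"
proof -
  show "0 \<le> bump 1 z" by (simp add: bump_def flat_def)
  show "bump 1 z \<le> indicator (cball 0 1) z"
    by (cases "norm z > 1") (auto simp: bump_outside, simp add: bump_def flat_def)
qed

abbreviation bump_mass :: "'n::finite itself \<Rightarrow> real" where
  "bump_mass _ \<equiv> (LINT w|lborel. bump 1 (w :: 'n phase))"

lemma bump_integrable: "integrable lborel (bump 1 :: 'n::finite phase \<Rightarrow> real)"
proof (rule Bochner_Integration.integrable_bound)
  show "integrable lborel (indicat_real (cball (0 :: 'n phase) 1))"
    by (intro integrable_real_indicator emeasure_bounded_finite) auto
  show "AE w in lborel. norm (bump 1 w) \<le> norm (indicat_real (cball (0 :: 'n phase) 1) w)"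
  proof (rule AE_I2)
    fix w :: "'n phase"
    show "norm (bump 1 w) \<le> norm (indicat_real (cball 0 1) w)"
      using bump_nonneg[of w] bump_le[of w] by simp
  qed
qed simp

text \<open>The bump is strictly positive on the open unit ball, which is not a null set. Positivity
  is what allows division by the mass in the final constant.\<close>

lemma bump_mass_pos: "bump_mass TYPE('n::finite) > 0"
proof -
  have "bump_mass TYPE('n) \<noteq> 0"
  proof
    assume "bump_mass TYPE('n) = 0"
    then have "AE w in lborel. bump 1 (w :: 'n phase) = 0"
      using integral_nonneg_eq_0_iff_AE[OF bump_integrable AE_I2[OF bump_nonneg]] by blast
    then have "AE w in lborel. w \<notin> ball (0 :: 'n phase) 1"
    proof (rule eventually_mono)
      fix w :: "'n phase" assume "bump 1 w = 0"
      then have "\<not> 1 - w \<bullet> w > 0" by (auto simp: bump_def flat_def)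
      then show "w \<notin> ball 0 1" by (simp add: norm_eq_sqrt_inner)
    qed
    then have "emeasure lborel (ball (0 :: 'n phase) 1) = 0"
      by (subst (asm) AE_iff_measurable[of "ball 0 1"]) auto
    then have "measure lborel (ball (0 :: 'n phase) 1) = 0" by (simp add: measure_def)
    then show False by simp
  qed
  moreover have "bump_mass TYPE('n) \<ge> 0"
    by (intro integral_nonneg_AE AE_I2 bump_nonneg)
  ultimately show ?thesis by simp
qed

text \<open>At scale 0 the map \<open>mv z 0\<close> is constantly \<open>z\<close>. Scales in
  [0, 1] and \<open>w\<close> in the ball form a compact set, so continuity supplies the bound for
  dominated convergence.\<close>

lemma kin_mol_continuous_limit:
  fixes \<phi> :: "'n::finite phase \<Rightarrow> real"
  assumes \<phi>: "continuous_on UNIV \<phi>"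
  shows "(\<lambda>k. kin_mol \<phi> z (1 / real (Suc k))) \<longlonglongrightarrow> bump_mass TYPE('n) * \<phi> z"
proof -
  have [measurable]: "\<phi> \<in> borel_measurable borel" by (rule borel_measurable_continuous_onI[OF \<phi>])
  let ?m = "\<lambda>(r, w). mv z r w"
  have m: "continuous_on A ?m" for A
    unfolding mv_def split_beta' by (intro continuous_intros)
  have mv_cont: "continuous_on UNIV (\<lambda>r. mv z r w)" for w
    unfolding mv_def by (intro continuous_intros)
  have "compact (\<phi> ` ?m ` ({0..1} \<times> cball 0 1))"
    by (intro compact_continuous_image m continuous_on_subset[OF \<phi>] compact_Times) auto
  then obtain M where M: "\<And>r w. r \<in> {0..1} \<Longrightarrow> w \<in> cball 0 1 \<Longrightarrow> \<bar>\<phi> (mv z r w)\<bar> \<le> M"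
    by (fastforce dest!: compact_imp_bounded simp: bounded_iff)
  have "(\<lambda>k. LINT w|lborel. \<phi> (mv z (1 / real (Suc k)) w) * bump 1 w) \<longlonglongrightarrow> (LINT w|lborel. \<phi> z * bump 1 (w :: 'n phase))"
  proof (rule integral_dominated_convergence[where w="\<lambda>w. M * bump 1 w"])
    show "integrable lborel (\<lambda>w. M * bump 1 (w :: 'n phase))"
      by (intro integrable_mult_right bump_integrable)
    show "AE w in lborel. norm (\<phi> (mv z (1 / real (Suc k)) w) * bump 1 w) \<le> M * bump 1 w" for k
    proof (rule AE_I2)
      fix w :: "'n phase"
      show "norm (\<phi> (mv z (1 / real (Suc k)) w) * bump 1 w) \<le> M * bump 1 w"
      proof (cases "norm w \<le> 1")
        case True
        then show ?thesis
          using M[of "1 / real (Suc k)" w] bump_nonneg[of w] by (simp add: abs_mult mult_right_mono)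
      next
        case False
        then show ?thesis by (simp add: bump_outside)
      qed
    qed
    show "AE w in lborel. (\<lambda>k. \<phi> (mv z (1 / real (Suc k)) w) * bump 1 w) \<longlonglongrightarrow> \<phi> z * bump 1 w"
    proof (rule AE_I2)
      fix w :: "'n phase"
      have "(\<lambda>k. 1 / real (Suc k)) \<longlonglongrightarrow> 0"
        using LIMSEQ_inverse_real_of_nat by (simp add: inverse_eq_divide)
      then have "(\<lambda>k. mv z (1 / real (Suc k)) w) \<longlonglongrightarrow> mv z 0 w"
        by (intro continuous_on_tendsto_compose[OF mv_cont]) auto
      moreover have "mv z 0 w = z" by (simp add: mv_def)
      ultimately have "(\<lambda>k. \<phi> (mv z (1 / real (Suc k)) w)) \<longlonglongrightarrow> \<phi> z"
        using continuous_on_tendsto_compose[OF \<phi>, of _ z] by simp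
      then show "(\<lambda>k. \<phi> (mv z (1 / real (Suc k)) w) * bump 1 w) \<longlonglongrightarrow> \<phi> z * bump 1 w"
        by (intro tendsto_intros)
    qed
  qed auto
  then show ?thesis unfolding kin_mol_def by (simp add: mult.commute)
qed

text \<open>The error is traded for its square, at the price of \<open>\<delta>\<close>, because
  averages of e^2 have an integral over \<open>z\<close> that does not depend on
  \<open>r\<close>.\<close>

lemma kin_mol_small:
  fixes e :: "'n::finite phase \<Rightarrow> real"
  assumes e: "L2 e" and r: "r > 0" and \<delta>: "\<delta> > 0"
  shows "ennreal \<bar>kin_mol e z r\<bar> \<le> ennreal (\<delta> * ball_vol TYPE('n)) + ennreal (1 / \<delta>) * kin_avg (\<lambda>u. ennreal ((e u)\<^sup>2)) z r"
proof -
  have [measurable]: "e \<in> borel_measurable borel" using e by (simp add: L2_def)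
  have "ennreal \<bar>kin_mol e z r\<bar> \<le> (\<integral>\<^sup>+w. ennreal (norm (e (mv z r w) * bump 1 w)) \<partial>lborel)"
    unfolding kin_mol_def
    using integral_norm_bound_ennreal[OF L2_mult_integrable[OF e pot_supp_ball(1) r]] by simp
  also have "\<dots> \<le> (\<integral>\<^sup>+w. ennreal \<delta> * indicator (cball 0 1) w + ennreal (1 / \<delta>) * (ennreal ((e (mv z r w))\<^sup>2) * indicator (cball 0 1) w) \<partial>lborel)"
  proof (rule nn_integral_mono)
    fix w :: "'n phase"
    have *: "\<bar>x\<bar> \<le> \<delta> + 1 / \<delta> * x\<^sup>2" for x
    proof -
      have "2 * \<delta> * \<bar>x\<bar> \<le> \<delta>\<^sup>2 + \<bar>x\<bar>\<^sup>2" by (rule sum_squares_bound)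
      then have "2 * \<bar>x\<bar> \<le> \<delta> + 1 / \<delta> * x\<^sup>2"
        using \<delta> by (simp add: field_simps power2_eq_square)
      then show ?thesis by linarith
    qed
    show "ennreal (norm (e (mv z r w) * bump 1 w)) \<le> ennreal \<delta> * indicator (cball 0 1) w + ennreal (1 / \<delta>) * (ennreal ((e (mv z r w))\<^sup>2) * indicator (cball 0 1) w)"
    proof (cases "norm w \<le> 1")
      case True
      have "norm (e (mv z r w) * bump 1 w) \<le> \<bar>e (mv z r w)\<bar> * 1"
        unfolding norm_mult using bump_le[of w] bump_nonneg[of w] True by (intro mult_mono) auto
      also have "\<dots> \<le> \<delta> + 1 / \<delta> * (e (mv z r w))\<^sup>2" using *[of "e (mv z r w)"] by simp
      finally have "ennreal (norm (e (mv z r w) * bump 1 w)) \<le> ennreal (\<delta> + 1 / \<delta> * (e (mv z r w))\<^sup>2)"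
        by (rule ennreal_leI)
      also have "\<dots> = ennreal \<delta> + ennreal (1 / \<delta>) * ennreal ((e (mv z r w))\<^sup>2)"
        using \<delta> by (simp add: ennreal_mult[symmetric])
      finally show ?thesis using True by simp
    next
      case False
      then show ?thesis by (simp add: bump_outside)
    qed
  qed
  also have "\<dots> = ennreal (\<delta> * ball_vol TYPE('n)) + ennreal (1 / \<delta>) * kin_avg (\<lambda>u. ennreal ((e u)\<^sup>2)) z r"
    unfolding kin_avg_def using \<delta>
    by (subst nn_integral_add, measurable, subst nn_integral_cmult, measurable, subst nn_integral_cmult_indicator)
       (simp_all add: emeasure_unit_cball ennreal_mult)
  finally show ?thesis .
qed

text \<open>A substitute for Lebesgue differentiation. Split \<open>f\<close> into a continuous
  function, whose mollifications converge everywhere, and an error \<open>e\<close> of small L^2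
  norm. The integral of the excess over U + O(\<delta>) is at most a constant times \<eta> /
  \<delta>; letting \<eta> tend to 0 at fixed \<delta> makes the excess vanish almost everywhere,
  and then \<delta> tends to 0.\<close>

lemma AE_le_if_kin_mol_le:
  fixes f :: "'n::finite phase \<Rightarrow> real" and U :: "'n phase \<Rightarrow> ennreal"
  assumes f: "L2 f" and U [measurable]: "U \<in> borel_measurable borel"
    and bound: "\<And>z r. r > 0 \<Longrightarrow> ennreal \<bar>kin_mol f z r\<bar> \<le> U z"
  shows "AE z in lborel. ennreal (bump_mass TYPE('n) * \<bar>f z\<bar>) \<le> U z"
proof -
  let ?c = "bump_mass TYPE('n)" and ?\<beta> = "ball_vol TYPE('n)"
  have c: "?c > 0" by (rule bump_mass_pos)
  have [measurable]: "f \<in> borel_measurable borel" using f by (simp add: L2_def)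
  \<comment> \<open>Subtraction in \<open>ennreal\<close> is truncated at 0, so \<open>?D\<close>
    records only the excess.\<close>
  let ?D = "\<lambda>\<delta> z. ennreal (?c * \<bar>f z\<bar>) - (U z + ennreal (\<delta> * (1 + ?\<beta>)))"
  have D: "(\<integral>\<^sup>+z. ?D \<delta> z \<partial>lborel) \<le> ennreal (1 / \<delta> * (?c\<^sup>2 + ?\<beta>) * \<eta>)" if \<delta>: "\<delta> > 0" and \<eta>: "\<eta> > 0" for \<delta> \<eta>
  proof -
    obtain \<phi> where \<phi>: "continuous_on UNIV \<phi>" and small: "(\<integral>\<^sup>+z. ennreal ((f z - \<phi> z)\<^sup>2) \<partial>lborel) \<le> ennreal \<eta>"
      using L2_continuous_approx[OF f \<eta>] .
    have [measurable]: "\<phi> \<in> borel_measurable borel" by (rule borel_measurable_continuous_onI[OF \<phi>])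
    define e where "e z = f z - \<phi> z" for z
    have [measurable]: "e \<in> borel_measurable borel" unfolding e_def[abs_def] by measurable
    have ei: "(\<integral>\<^sup>+z. ennreal ((e z)\<^sup>2) \<partial>lborel) \<le> ennreal \<eta>" using small by (simp add: e_def)
    have e: "L2 e"
      using le_less_trans[OF ei, of \<infinity>] by (auto simp: L2_def integrable_iff_bounded)
    define rk where "rk k = 1 / real (Suc k)" for k
    have rk: "rk k > 0" for k by (simp add: rk_def)
    \<comment> \<open>A liminf over scales can be integrated by Fatou's lemma, whereas a supremum
      would call for a maximal inequality.\<close>
    define W where "W z = ennreal (1 / \<delta>) * (ennreal (?c\<^sup>2) * ennreal ((e z)\<^sup>2) + liminf (\<lambda>k. kin_avg (\<lambda>u. ennreal ((e u)\<^sup>2)) z (rk k)))" for z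
    have avg [measurable]: "(\<lambda>z. kin_avg (\<lambda>u. ennreal ((e u)\<^sup>2)) z (rk k)) \<in> borel_measurable borel" for k
      by (intro kin_avg_measurable) measurable
    have "ennreal (?c * \<bar>f z\<bar>) \<le> (U z + ennreal (\<delta> * (1 + ?\<beta>))) + W z" for z
    proof -
      let ?A = "\<lambda>k. kin_avg (\<lambda>u. ennreal ((e u)\<^sup>2)) z (rk k)"
      have "(\<lambda>k. \<bar>kin_mol \<phi> z (rk k)\<bar>) \<longlonglongrightarrow> \<bar>?c * \<phi> z\<bar>"
        unfolding rk_def by (intro tendsto_rabs kin_mol_continuous_limit[OF \<phi>])
      then have "(\<lambda>k. ennreal \<bar>kin_mol \<phi> z (rk k)\<bar>) \<longlonglongrightarrow> ennreal \<bar>?c * \<phi> z\<bar>"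
        by (rule tendsto_ennrealI)
      then have "ennreal \<bar>?c * \<phi> z\<bar> = liminf (\<lambda>k. ennreal \<bar>kin_mol \<phi> z (rk k)\<bar>)"
        by (intro lim_imp_Liminf[symmetric]) simp
      also have "\<dots> \<le> liminf (\<lambda>k. (U z + ennreal (\<delta> * ?\<beta>)) + ennreal (1 / \<delta>) * ?A k)"
      proof (intro Liminf_mono always_eventually allI)
        fix k
        have "kin_mol \<phi> z (rk k) = kin_mol f z (rk k) - kin_mol e z (rk k)"
          unfolding kin_mol_def e_def
        proof (subst Bochner_Integration.integral_diff[symmetric])
          show "integrable lborel (\<lambda>w. f (mv z (rk k) w) * bump 1 w)"
            by (rule L2_mult_integrable[OF f pot_supp_ball(1) rk])
          show "integrable lborel (\<lambda>w. (f (mv z (rk k) w) - \<phi> (mv z (rk k) w)) * bump 1 w)"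
            using L2_mult_integrable[OF e pot_supp_ball(1) rk] by (simp add: e_def)
        qed (simp add: algebra_simps)
        then have "ennreal \<bar>kin_mol \<phi> z (rk k)\<bar> \<le> ennreal (\<bar>kin_mol f z (rk k)\<bar> + \<bar>kin_mol e z (rk k)\<bar>)"
          by (intro ennreal_leI) simp
        also have "\<dots> = ennreal \<bar>kin_mol f z (rk k)\<bar> + ennreal \<bar>kin_mol e z (rk k)\<bar>"
          by simp
        also have "\<dots> \<le> U z + (ennreal (\<delta> * ?\<beta>) + ennreal (1 / \<delta>) * ?A k)"
          by (intro add_mono bound rk kin_mol_small[OF e rk \<delta>])
        finally show "ennreal \<bar>kin_mol \<phi> z (rk k)\<bar> \<le> (U z + ennreal (\<delta> * ?\<beta>)) + ennreal (1 / \<delta>) * ?A k"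
          by (simp add: add.assoc)
      qed
      \<comment> \<open>Adding and scaling are continuous and monotone on \<open>ennreal\<close>,
        hence commute with the liminf.\<close>
      also have "\<dots> = (U z + ennreal (\<delta> * ?\<beta>)) + ennreal (1 / \<delta>) * liminf ?A"
        by (rule Liminf_compose_continuous_mono)
           (auto intro!: continuous_intros ennreal_continuous_on_cmult monoI add_left_mono mult_left_mono)
      finally have 1: "ennreal \<bar>?c * \<phi> z\<bar> \<le> (U z + ennreal (\<delta> * ?\<beta>)) + ennreal (1 / \<delta>) * liminf ?A" .
      have "2 * \<delta> * \<bar>?c * e z\<bar> \<le> \<delta>\<^sup>2 + \<bar>?c * e z\<bar>\<^sup>2" by (rule sum_squares_bound)
      then have "2 * \<bar>?c * e z\<bar> \<le> \<delta> + 1 / \<delta> * (?c\<^sup>2 * (e z)\<^sup>2)"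
        using \<delta> by (simp add: field_simps power2_eq_square)
      then have "\<bar>?c * e z\<bar> \<le> \<delta> + 1 / \<delta> * (?c\<^sup>2 * (e z)\<^sup>2)" by linarith
      then have "ennreal \<bar>?c * e z\<bar> \<le> ennreal (\<delta> + 1 / \<delta> * (?c\<^sup>2 * (e z)\<^sup>2))" by (rule ennreal_leI)
      also have "\<dots> = ennreal \<delta> + ennreal (1 / \<delta>) * (ennreal (?c\<^sup>2) * ennreal ((e z)\<^sup>2))"
        using \<delta> by (simp only: ennreal_plus ennreal_mult less_imp_le divide_nonneg_nonneg mult_nonneg_nonneg zero_le_power2 zero_le_one)
      finally have 2: "ennreal \<bar>?c * e z\<bar> \<le> ennreal \<delta> + ennreal (1 / \<delta>) * (ennreal (?c\<^sup>2) * ennreal ((e z)\<^sup>2))" .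
      have "?c * f z = ?c * \<phi> z + ?c * e z" by (simp add: e_def algebra_simps)
      then have "?c * \<bar>f z\<bar> \<le> \<bar>?c * \<phi> z\<bar> + \<bar>?c * e z\<bar>"
        using c abs_triangle_ineq[of "?c * \<phi> z" "?c * e z"] by (simp add: abs_mult)
      then have "ennreal (?c * \<bar>f z\<bar>) \<le> ennreal \<bar>?c * \<phi> z\<bar> + ennreal \<bar>?c * e z\<bar>"
        by (simp add: ennreal_plus[symmetric] ennreal_leI del: ennreal_plus)
      also have "\<dots> \<le> ((U z + ennreal (\<delta> * ?\<beta>)) + ennreal (1 / \<delta>) * liminf ?A) + (ennreal \<delta> + ennreal (1 / \<delta>) * (ennreal (?c\<^sup>2) * ennreal ((e z)\<^sup>2)))"
        by (intro add_mono 1 2)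
      also have "\<dots> = (U z + (ennreal (\<delta> * ?\<beta>) + ennreal \<delta>)) + W z"
        unfolding W_def by (simp only: distrib_left add_ac)
      also have "ennreal (\<delta> * ?\<beta>) + ennreal \<delta> = ennreal (\<delta> * (1 + ?\<beta>))"
        using \<delta> by (simp add: ennreal_plus[symmetric] algebra_simps del: ennreal_plus)
      finally show ?thesis .
    qed
    then have "(\<integral>\<^sup>+z. ?D \<delta> z \<partial>lborel) \<le> (\<integral>\<^sup>+z. W z \<partial>lborel)"
      by (intro nn_integral_mono) (simp add: ennreal_minus_le_iff)
    also have "\<dots> = ennreal (1 / \<delta>) * (ennreal (?c\<^sup>2) * (\<integral>\<^sup>+z. ennreal ((e z)\<^sup>2) \<partial>lborel) + (\<integral>\<^sup>+z. liminf (\<lambda>k. kin_avg (\<lambda>u. ennreal ((e u)\<^sup>2)) z (rk k)) \<partial>lborel))"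
      unfolding W_def by (subst nn_integral_cmult, measurable, subst nn_integral_add, measurable, subst nn_integral_cmult, measurable)
    also have "\<dots> \<le> ennreal (1 / \<delta>) * (ennreal (?c\<^sup>2) * ennreal \<eta> + ennreal ?\<beta> * ennreal \<eta>)"
    proof (intro mult_left_mono add_mono ei)
      have "(\<integral>\<^sup>+z. liminf (\<lambda>k. kin_avg (\<lambda>u. ennreal ((e u)\<^sup>2)) z (rk k)) \<partial>lborel) \<le> liminf (\<lambda>k. \<integral>\<^sup>+z. kin_avg (\<lambda>u. ennreal ((e u)\<^sup>2)) z (rk k) \<partial>lborel)"
        by (rule nn_integral_liminf) measurable
      also have "\<dots> = ennreal ?\<beta> * (\<integral>\<^sup>+z. ennreal ((e z)\<^sup>2) \<partial>lborel)"
        by (subst nn_integral_kin_avg) (auto simp: Liminf_const)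
      also have "\<dots> \<le> ennreal ?\<beta> * ennreal \<eta>"
        by (intro mult_left_mono ei) simp
      finally show "(\<integral>\<^sup>+z. liminf (\<lambda>k. kin_avg (\<lambda>u. ennreal ((e u)\<^sup>2)) z (rk k)) \<partial>lborel) \<le> ennreal ?\<beta> * ennreal \<eta>" .
    qed auto
    also have "\<dots> = ennreal (1 / \<delta> * (?c\<^sup>2 + ?\<beta>) * \<eta>)"
      using \<delta> \<eta> by (simp add: ennreal_mult[symmetric] ennreal_plus[symmetric] algebra_simps add_divide_distrib del: ennreal_plus)
    finally show ?thesis .
  qed
  have null: "AE z in lborel. ?D \<delta> z = 0" if \<delta>: "\<delta> > 0" for \<delta>
  proof -
    let ?K = "1 / \<delta> * (?c\<^sup>2 + ?\<beta>)"
    have cancel: "k * (x / k) = x" if "k > 0" for k x :: real using that by simp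
    have K: "?K > 0" using \<delta> c by (simp add: add_pos_nonneg)
    have "(\<integral>\<^sup>+z. ?D \<delta> z \<partial>lborel) \<le> 0"
    proof (rule ennreal_le_epsilon)
      fix x :: real assume x: "x > 0"
      have "(\<integral>\<^sup>+z. ?D \<delta> z \<partial>lborel) \<le> ennreal (?K * (x / ?K))"
        by (intro D \<delta> divide_pos_pos x K)
      also have "?K * (x / ?K) = x" by (rule cancel[OF K])
      finally show "(\<integral>\<^sup>+z. ?D \<delta> z \<partial>lborel) \<le> 0 + ennreal x" by simp
    qed
    then have "(\<integral>\<^sup>+z. ?D \<delta> z \<partial>lborel) = 0" by simp
    then show ?thesis by (subst (asm) nn_integral_0_iff_AE) auto
  qed
  \<comment> \<open>Countably many values of \<delta>, so that the exceptional sets unite to a null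
    set.\<close>
  have "AE z in lborel. \<forall>k :: nat. ?D (1 / real (Suc k)) z = 0"
    by (subst AE_all_countable, intro allI null) simp
  then show ?thesis
  proof (rule eventually_mono)
    fix z assume z: "\<forall>k :: nat. ?D (1 / real (Suc k)) z = 0"
    have "(\<lambda>k. U z + ennreal (1 / real (Suc k) * (1 + ?\<beta>))) \<longlonglongrightarrow> U z + ennreal (0 * (1 + ?\<beta>))"
      using LIMSEQ_inverse_real_of_nat by (intro tendsto_intros tendsto_ennrealI) (simp add: inverse_eq_divide)
    moreover have "ennreal (?c * \<bar>f z\<bar>) \<le> U z + ennreal (1 / real (Suc k) * (1 + ?\<beta>))" for k
      using z[rule_format, of k] by (simp only: diff_eq_0_iff_ennreal)
    ultimately have "ennreal (?c * \<bar>f z\<bar>) \<le> U z + ennreal (0 * (1 + ?\<beta>))"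
      by (intro LIMSEQ_le_const) auto
    then show "ennreal (?c * \<bar>f z\<bar>) \<le> U z" by simp
  qed
qed

section \<open>The kinetic Sobolev inequality\<close>

text \<open>The factor 2 on the right replaces Minkowski's inequality by 2 a^2 + 2 b^2 <= (2 (a +
  b))^2.\<close>

lemma nn_integral_norm_sum_square:
  fixes g S :: "'n::finite phase \<Rightarrow> real ^ 'n"
  assumes g: "L2v g" and S: "L2v S"
  shows "(\<integral>\<^sup>+z. ennreal ((norm (g z) + norm (S z))\<^sup>2) \<partial>lborel) \<le> ennreal ((2 * (L2norm_v g + L2norm_v S))\<^sup>2)"
proof -
  have [measurable]: "g \<in> borel_measurable borel" "S \<in> borel_measurable borel"
    and int: "integrable lborel (\<lambda>z. (norm (g z))\<^sup>2)" "integrable lborel (\<lambda>z. (norm (S z))\<^sup>2)"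
    using g S by (auto simp: L2v_def)
  have sq: "(LINT z|lborel. (norm (u z))\<^sup>2) = (L2norm_v u)\<^sup>2" for u :: "'n phase \<Rightarrow> real ^ 'n"
    by (simp add: L2norm_v_def Bochner_Integration.integral_nonneg)
  have nonneg: "L2norm_v u \<ge> 0" for u :: "'n phase \<Rightarrow> real ^ 'n"
    by (simp add: L2norm_v_def Bochner_Integration.integral_nonneg)
  have "(\<integral>\<^sup>+z. ennreal ((norm (g z) + norm (S z))\<^sup>2) \<partial>lborel)
    \<le> (\<integral>\<^sup>+z. ennreal (2 * (norm (g z))\<^sup>2 + 2 * (norm (S z))\<^sup>2) \<partial>lborel)"
  proof (intro nn_integral_mono ennreal_leI)
    fix z
    show "(norm (g z) + norm (S z))\<^sup>2 \<le> 2 * (norm (g z))\<^sup>2 + 2 * (norm (S z))\<^sup>2"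
      using sum_squares_bound[of "norm (g z)" "norm (S z)"] by (simp add: power2_sum)
  qed
  also have "\<dots> = ennreal (LINT z|lborel. 2 * (norm (g z))\<^sup>2 + 2 * (norm (S z))\<^sup>2)"
    using int by (intro nn_integral_eq_integral) auto
  also have "(LINT z|lborel. 2 * (norm (g z))\<^sup>2 + 2 * (norm (S z))\<^sup>2) = 2 * (L2norm_v g)\<^sup>2 + 2 * (L2norm_v S)\<^sup>2"
    using int by (simp add: sq)
  also have "\<dots> \<le> (2 * (L2norm_v g + L2norm_v S))\<^sup>2"
    using mult_nonneg_nonneg[OF nonneg[of g] nonneg[of S]] by (simp add: power_mult_distrib power2_sum)
  finally show ?thesis by (simp add: ennreal_leI)
qed

theorem mainTheorem4:
  "\<exists>C>0. \<forall>(f :: 'n::finite phase \<Rightarrow> real) (g :: 'n phase \<Rightarrow> real ^ 'n) (S :: 'n phase \<Rightarrow> real ^ 'n).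
     L2 f \<and> L2v g \<and> weak_grad_v f g \<and> L2v S \<and> kinetic_eq f S \<longrightarrow>
     (let \<kappa> = 1 + 1 / (2 * real CARD('n)) in
        integrable lborel (\<lambda>z. \<bar>f z\<bar> powr (2 * \<kappa>)) \<and>
        (LINT z|lborel. \<bar>f z\<bar> powr (2 * \<kappa>)) powr (1 / (2 * \<kappa>))
          \<le> C * (L2norm_v g + L2norm_v S))"
proof -
  define \<alpha> \<beta> where "\<alpha> = 1 / (2 * real CARD('n))" and "\<beta> = ball_vol TYPE('n)"
  define p where "p = 2 * (1 + \<alpha>)"
  define K where "K = 32 * \<beta>\<^sup>2 * (2 * (1 + \<beta>)) powr (2 * \<alpha>)"
  have \<beta>: "\<beta> > 0" by (simp add: \<beta>_def)
  have p: "p > 0" by (simp add: p_def \<alpha>_def add_pos_nonneg)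
  have K: "K > 0" using \<beta> by (simp add: K_def)
  obtain C0 where C0: "C0 \<ge> 0" and mol: "\<And>(f :: 'n phase \<Rightarrow> real) g S z r.
    L2 f \<Longrightarrow> L2v g \<Longrightarrow> weak_grad_v f g \<Longrightarrow> L2v S \<Longrightarrow> kinetic_eq f S \<Longrightarrow> r > 0 \<Longrightarrow>
    ennreal \<bar>kin_mol f z r\<bar> \<le> ennreal C0 * kin_pot (\<lambda>u. ennreal (norm (g u) + norm (S u))) z"
    using kin_mol_bound by blast
  \<comment> \<open>Scaling \<open>f\<close> by \<open>d\<close> gives the pointwise bound by the
    potential the constant 1; \<open>C0 + 1\<close> avoids division by 0, since \<open>C0\<close>
    may vanish.\<close>
  define d where "d = bump_mass TYPE('n) / (C0 + 1)"
  have d: "d > 0" unfolding d_def using C0 by (intro divide_pos_pos bump_mass_pos) simp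
  \<comment> \<open>\<open>K\<close> is the constant of the potential estimate,
    \<open>d powr - p\<close> undoes the scaling of \<open>f\<close>, and 2 comes from the L^2 bound
    on |g| + |S|.\<close>
  define C where "C = (K * d powr - p) powr (1 / p) * 2"
  have "C > 0" using K d by (simp add: C_def)
  moreover have "integrable lborel (\<lambda>z. \<bar>f z\<bar> powr p) \<and>
      (LINT z|lborel. \<bar>f z\<bar> powr p) powr (1 / p) \<le> C * (L2norm_v g + L2norm_v S)"
    if f: "L2 f" and g: "L2v g" and fg: "weak_grad_v f g" and S: "L2v S" and fS: "kinetic_eq f S"
    for f :: "'n phase \<Rightarrow> real" and g S
  proof -
    have [measurable]: "f \<in> borel_measurable borel" "g \<in> borel_measurable borel" "S \<in> borel_measurable borel"
      using f g S by (auto simp: L2_def L2v_def)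
    let ?h = "\<lambda>u. norm (g u) + norm (S u)"
    let ?pot = "kin_pot (\<lambda>u. ennreal (?h u))"
    have [measurable]: "?pot \<in> borel_measurable borel" by (rule kin_pot_measurable) measurable
    define L where "L = 2 * (L2norm_v g + L2norm_v S)"
    have L: "L \<ge> 0" by (simp add: L_def L2norm_v_def Bochner_Integration.integral_nonneg)
    have "AE z in lborel. ennreal (bump_mass TYPE('n) * \<bar>f z\<bar>) \<le> ennreal C0 * ?pot z"
      by (rule AE_le_if_kin_mol_le[OF f]) (measurable, rule mol[OF f g fg S fS])
    then have AE: "AE z in lborel. ennreal \<bar>d * f z\<bar> \<le> ?pot z"
    proof (rule eventually_mono)
      fix z assume "ennreal (bump_mass TYPE('n) * \<bar>f z\<bar>) \<le> ennreal C0 * ?pot z"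
      also have "\<dots> \<le> ennreal (C0 + 1) * ?pot z"
        by (intro mult_right_mono ennreal_leI) auto
      finally have "ennreal (1 / (C0 + 1)) * ennreal (bump_mass TYPE('n) * \<bar>f z\<bar>) \<le> ennreal (1 / (C0 + 1)) * (ennreal (C0 + 1) * ?pot z)"
        by (rule mult_left_mono) simp
      also have "\<dots> = ?pot z"
        using C0 by (simp add: mult.assoc[symmetric] ennreal_mult[symmetric] del: ennreal_plus)
      also have "ennreal (1 / (C0 + 1)) * ennreal (bump_mass TYPE('n) * \<bar>f z\<bar>) = ennreal \<bar>d * f z\<bar>"
        using C0 bump_mass_pos[where 'n='n] by (simp add: d_def abs_mult ennreal_mult[symmetric] del: ennreal_plus)
      finally show "ennreal \<bar>d * f z\<bar> \<le> ?pot z" .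
    qed
    \<comment> \<open>\<open>kin_pot_powr_bound\<close> asks for a positive \<open>H\<close> while
      \<open>L\<close> may be 0, so the estimate is made for every H > L and then passed to the
      limit.\<close>
    have bound: "(\<integral>\<^sup>+z. ennreal (\<bar>d * f z\<bar> powr p) \<partial>lborel) \<le> ennreal (K * H powr p)" if H: "H > L" for H
    proof -
      have "ennreal (L\<^sup>2) \<le> ennreal (H\<^sup>2)"
        using H L by (intro ennreal_leI power_mono) auto
      then have "(\<integral>\<^sup>+z. ennreal ((?h z)\<^sup>2) \<partial>lborel) \<le> ennreal (H\<^sup>2)"
        using nn_integral_norm_sum_square[OF g S] unfolding L_def by (rule order_trans[rotated])
      then show ?thesis
        unfolding p_def K_def \<alpha>_def \<beta>_def
        by (intro kin_pot_powr_bound[OF _ _ _ _ _ AE]) (use H L in auto)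
    qed
    have lim: "(\<lambda>k. ennreal (K * (L + 1 / real (Suc k)) powr p)) \<longlonglongrightarrow> ennreal (K * (L + 0) powr p)"
    proof (intro tendsto_ennrealI tendsto_mult tendsto_const tendsto_powr' tendsto_add)
      show "(\<lambda>k. 1 / real (Suc k)) \<longlonglongrightarrow> 0"
        using LIMSEQ_inverse_real_of_nat by (simp add: inverse_eq_divide)
      show "L + 0 \<noteq> 0 \<or> 0 < p \<and> (\<forall>\<^sub>F k in sequentially. 0 \<le> L + 1 / real (Suc k))"
        using p L by simp
    qed
    have "(\<integral>\<^sup>+z. ennreal (\<bar>d * f z\<bar> powr p) \<partial>lborel) \<le> ennreal (K * (L + 0) powr p)"
      by (rule LIMSEQ_le_const[OF lim]) (auto intro!: bound exI[of _ 0])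
    then have "ennreal (d powr - p) * (\<integral>\<^sup>+z. ennreal (\<bar>d * f z\<bar> powr p) \<partial>lborel) \<le> ennreal (d powr - p) * ennreal (K * L powr p)"
      by (intro mult_left_mono) auto
    also have "ennreal (d powr - p) * (\<integral>\<^sup>+z. ennreal (\<bar>d * f z\<bar> powr p) \<partial>lborel) = (\<integral>\<^sup>+z. ennreal (\<bar>f z\<bar> powr p) \<partial>lborel)"
    proof -
      have "ennreal (d powr - p) * ennreal (\<bar>d * f z\<bar> powr p) = ennreal (\<bar>f z\<bar> powr p)" for z
        using d by (simp add: abs_mult powr_mult ennreal_mult[symmetric] mult.assoc[symmetric] powr_add[symmetric])
      then show ?thesis by (subst nn_integral_cmult[symmetric]) auto
    qed
    finally have main: "(\<integral>\<^sup>+z. ennreal (\<bar>f z\<bar> powr p) \<partial>lborel) \<le> ennreal (K * d powr - p * L powr p)"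
      using K by (simp add: ennreal_mult[symmetric] ac_simps)
    have int: "integrable lborel (\<lambda>z. \<bar>f z\<bar> powr p)"
      using le_less_trans[OF main, of \<infinity>] by (intro integrableI_bounded) auto
    have "ennreal (LINT z|lborel. \<bar>f z\<bar> powr p) \<le> ennreal (K * d powr - p * L powr p)"
      using main nn_integral_eq_integral[OF int] by simp
    then have "(LINT z|lborel. \<bar>f z\<bar> powr p) \<le> K * d powr - p * L powr p"
      using K by (subst (asm) ennreal_le_iff) auto
    then have "(LINT z|lborel. \<bar>f z\<bar> powr p) powr (1 / p) \<le> (K * d powr - p * L powr p) powr (1 / p)"
      using p by (intro powr_mono2 Bochner_Integration.integral_nonneg) auto
    also have "\<dots> = C * (L2norm_v g + L2norm_v S)"
    proof -
      have "(L powr p) powr (1 / p) = L"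
        using p L by (simp add: powr_powr)
      then show ?thesis
        using K d L by (simp add: powr_mult C_def L_def)
    qed
    finally show ?thesis using int by blast
  qed
  ultimately show ?thesis
    unfolding Let_def p_def \<alpha>_def by blast
qed

end
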